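(* Let $F$ be a field with a valuation $v$ and let $E/F$ be a finite field extension. Consider quasi-valuations $w$ on $E$ extending $v$ whose value monoid $M_w$ is weakly cancellative, and call the rings $O_w=\{x\in E\mid w(x)\ge0\}$ of such $w$ quasi-valuation rings. Then: (1) For every exponential such $w$, the ring $O_w$ is integrally closed in $E$. (2) Conversely, every quasi-valuation ring $O_w$ that is integrally closed in $E$ is of the form $O_w=I_E(O_w)=\bigcap_{i=1}^kO_{u_i}$, where each $u_i$ is a valuation on $E$ extending $v$ (and $I_E(O_w)$ is the integral closure of $O_w$ in $E$), and hence it is the quasi-valuation ring of a unique exponential quasi-valuation extending $v$, namely $\min\{u_1,\dots,u_k\}$. In other words, $w\mapsto O_w$ is a bijection from the set of exponential quasi-valuations on $E$ extending $v$ (with weakly cancellative value monoid) onto the set of quasi-valuation rings that are integrally closed in $E$.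
   Context: A totally ordered abelian monoid is a commutative monoid $(M,+)$ with a total order such that $a\le b$ implies $a+c\le b+c$. One adjoins $\infty$, greater than all elements of $M$, with $m+\infty=\infty$. A quasi-valuation on a ring $A$ is a function $w:A\to M\cup\{\infty\}$, $M$ a totally ordered abelian monoid, with $w(0)=\infty$, $w(xy)\ge w(x)+w(y)$ and $w(x+y)\ge\min\{w(x),w(y)\}$ for all $x,y\in A$. $w$ extends $v$ means that the value group $\Gamma_v$ of $v$ is contained in $M$ as an ordered submonoid and $w|_F=v$. $M_w$ is the submonoid of $M$ generated by $w(E\setminus\{0\})$ (for $x\neq 0$ one has $w(x)\neq\infty$). A monoid is weakly cancellative if $a+b=a$ implies $b=0$. $w$ is exponential if $w(x^m)=m\,w(x)$ for all $x\in E$ and $m\in\mathbb N$. Convention: if $w$ is exponential with $M_w$ weakly cancellative then $M_w$ is a group that is torsion over $\Gamma_v$; likewise the value group of every valuation of $E$ extending $v$ is torsion over $\Gamma_v$. All of these are regarded as subgroups of the divisible hull $\Gamma_{\text{div}}$ of $\Gamma_v$ (via the unique order embedding over $\Gamma_v$), and equality of quasi-valuations, and the minimum, are taken in $\Gamma_{\text{div}}\cup\{\infty\}$. *)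

theory Defs
  imports "HOL-Computational_Algebra.Polynomial"
begin

section \<open>Adjoining a largest, absorbing element\<close>

datatype 'a with_infty = Fin 'a | Infty

instantiation with_infty :: (linorder) linorder
begin

fun less_eq_with_infty :: "'a with_infty \<Rightarrow> 'a with_infty \<Rightarrow> bool" where
  "Fin a \<le> Fin b \<longleftrightarrow> a \<le> b"
| "x \<le> Infty \<longleftrightarrow> True"
| "Infty \<le> Fin b \<longleftrightarrow> False"

definition less_with_infty :: "'a with_infty \<Rightarrow> 'a with_infty \<Rightarrow> bool" where
  "x < y \<longleftrightarrow> x \<le> y \<and> \<not> y \<le> x" for x y :: "'a with_infty"

instance
proof
  fix x y z :: "'a with_infty"
  show "x < y \<longleftrightarrow> x \<le> y \<and> \<not> y \<le> x" by (fact less_with_infty_def)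
  show "x \<le> x" by (cases x) auto
  show "x \<le> y \<Longrightarrow> y \<le> z \<Longrightarrow> x \<le> z" by (cases x; cases y; cases z) auto
  show "x \<le> y \<Longrightarrow> y \<le> x \<Longrightarrow> x = y" by (cases x; cases y) auto
  show "x \<le> y \<or> y \<le> x" by (cases x; cases y) auto
qed

end

instantiation with_infty :: (comm_monoid_add) comm_monoid_add
begin

definition zero_with_infty :: "'a with_infty" where
  "0 = Fin 0"

fun plus_with_infty :: "'a with_infty \<Rightarrow> 'a with_infty \<Rightarrow> 'a with_infty" where
  "Fin a + Fin b = Fin (a + b)"
| "Infty + y = Infty"
| "x + Infty = Infty"

instance
proof
  fix x y z :: "'a with_infty"
  show "x + y + z = x + (y + z)" by (cases x; cases y; cases z) (auto simp: add.assoc)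
  show "x + y = y + x" by (cases x; cases y) (auto simp: add.commute)
  show "0 + x = x" by (cases x) (auto simp: zero_with_infty_def)
qed

end

instance with_infty :: ("{linorder, ordered_comm_monoid_add}") ordered_comm_monoid_add
proof
  fix x y z :: "'a with_infty"
  show "x \<le> y \<Longrightarrow> z + x \<le> z + y"
    by (cases x; cases y; cases z) (auto intro: add_left_mono)
qed


section \<open>Natural multiples in a monoid\<close>

primrec nsmul :: "nat \<Rightarrow> 'a::comm_monoid_add \<Rightarrow> 'a" where
  "nsmul 0 a = 0"
| "nsmul (Suc n) a = a + nsmul n a"

lemma nsmul_zero [simp]: "nsmul n 0 = 0"
  by (induction n) auto

lemma nsmul_one [simp]: "nsmul (Suc 0) a = a"
  by simp

lemma nsmul_add: "nsmul n (a + b) = nsmul n a + nsmul n b"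
  by (induction n) (auto simp: algebra_simps)

lemma nsmul_add_left: "nsmul (m + n) a = nsmul m a + nsmul n a"
  by (induction m) (auto simp: algebra_simps)

lemma nsmul_mult: "nsmul (m * n) a = nsmul m (nsmul n a)"
  by (induction m) (auto simp: nsmul_add_left)

lemma nsmul_commute: "nsmul m (nsmul n a) = nsmul n (nsmul m a)"
  by (metis mult.commute nsmul_mult)

lemma nsmul_uminus: "nsmul n (- a) = - nsmul n (a :: 'a::ab_group_add)"
  by (induction n) auto

lemma nsmul_mono: "a \<le> b \<Longrightarrow> nsmul n a \<le> nsmul n (b :: 'a::linordered_ab_group_add)"
  by (induction n) (auto intro: add_mono)

lemma nsmul_strict_mono:
  "a < b \<Longrightarrow> 0 < n \<Longrightarrow> nsmul n a < nsmul n (b :: 'a::linordered_ab_group_add)"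
  by (induction n) (auto intro: add_less_le_mono nsmul_mono less_imp_le)

lemma nsmul_le_iff [simp]:
  "0 < n \<Longrightarrow> nsmul n a \<le> nsmul n b \<longleftrightarrow> a \<le> (b :: 'a::linordered_ab_group_add)"
  by (meson linorder_not_le nsmul_mono nsmul_strict_mono)

lemma nsmul_eq_iff [simp]:
  "0 < n \<Longrightarrow> nsmul n a = nsmul n b \<longleftrightarrow> a = (b :: 'a::linordered_ab_group_add)"
  by (metis nsmul_le_iff order_antisym order_refl)


section \<open>The divisible hull of a totally ordered abelian group\<close>

text \<open>A pair \<open>(a, m)\<close> with \<open>m > 0\<close> stands for the fraction \<open>a / m\<close>.\<close>

definition div_hull_rel :: "'a::linordered_ab_group_add \<times> nat \<Rightarrow> 'a \<times> nat \<Rightarrow> bool" where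
  "div_hull_rel p q \<longleftrightarrow>
    0 < snd p \<and> 0 < snd q \<and> nsmul (snd q) (fst p) = nsmul (snd p) (fst q)"

lemma div_hull_rel_cross:
  assumes "div_hull_rel p p'"
  shows "nsmul (snd p' * snd q') (nsmul (snd q) (fst p)) =
    nsmul (snd p * snd q) (nsmul (snd q') (fst p'))"
proof -
  have "nsmul (snd p' * snd q') (nsmul (snd q) (fst p)) =
      nsmul (snd q' * snd q) (nsmul (snd p') (fst p))"
    by (simp add: mult_ac flip: nsmul_mult)
  also have "nsmul (snd p') (fst p) = nsmul (snd p) (fst p')"
    using assms by (simp add: div_hull_rel_def)
  finally show ?thesis
    by (simp add: mult_ac flip: nsmul_mult)
qed

lemma part_equivp_div_hull_rel:
  "part_equivp (div_hull_rel :: 'a::linordered_ab_group_add \<times> nat \<Rightarrow> _)"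
proof (rule part_equivpI)
  show "\<exists>p. div_hull_rel p p"
    by (rule exI[of _ "(0, 1)"]) (simp add: div_hull_rel_def)
  show "symp div_hull_rel"
    by (auto simp: symp_def div_hull_rel_def)
  show "transp (div_hull_rel :: 'a \<times> nat \<Rightarrow> _)"
  proof (rule transpI)
    fix p q r :: "'a \<times> nat"
    assume pq: "div_hull_rel p q" and qr: "div_hull_rel q r"
    have "nsmul (snd q) (nsmul (snd r) (fst p)) = nsmul (snd q) (nsmul (snd p) (fst r))"
      using pq qr unfolding div_hull_rel_def by (metis nsmul_commute)
    then show "div_hull_rel p r"
      using pq qr by (auto simp: div_hull_rel_def)
  qed
qed

quotient_type (overloaded) 'a div_hull = "'a::linordered_ab_group_add \<times> nat" / partial: div_hull_rel
  by (rule part_equivp_div_hull_rel)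

instantiation div_hull :: (linordered_ab_group_add) linordered_ab_group_add
begin

lift_definition zero_div_hull :: "'a div_hull" is "(0, 1)"
  by (simp add: div_hull_rel_def)

lift_definition plus_div_hull :: "'a div_hull \<Rightarrow> 'a div_hull \<Rightarrow> 'a div_hull"
  is "\<lambda>p q. (nsmul (snd q) (fst p) + nsmul (snd p) (fst q), snd p * snd q)"
proof -
  fix p p' q q' :: "'a \<times> nat"
  assume p: "div_hull_rel p p'" and q: "div_hull_rel q q'"
  note 1 = div_hull_rel_cross[OF p, of q' q]
    and 2 = div_hull_rel_cross[OF q, of p' p, unfolded mult.commute[of "snd q'"] mult.commute[of "snd q"]]
  show "div_hull_rel (nsmul (snd q) (fst p) + nsmul (snd p) (fst q), snd p * snd q)
      (nsmul (snd q') (fst p') + nsmul (snd p') (fst q'), snd p' * snd q')"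
    using p q by (simp add: div_hull_rel_def nsmul_add 1 2)
qed

lift_definition uminus_div_hull :: "'a div_hull \<Rightarrow> 'a div_hull"
  is "\<lambda>p. (- fst p, snd p)"
  by (simp add: div_hull_rel_def nsmul_uminus)

definition minus_div_hull :: "'a div_hull \<Rightarrow> 'a div_hull \<Rightarrow> 'a div_hull" where
  "x - y = x + - y" for x y :: "'a div_hull"

lift_definition less_eq_div_hull :: "'a div_hull \<Rightarrow> 'a div_hull \<Rightarrow> bool"
  is "\<lambda>p q. nsmul (snd q) (fst p) \<le> nsmul (snd p) (fst q)"
proof -
  fix p p' q q' :: "'a \<times> nat"
  assume p: "div_hull_rel p p'" and q: "div_hull_rel q q'"
  have pos: "0 < snd p" "0 < snd p'" "0 < snd q" "0 < snd q'"
    using p q by (auto simp: div_hull_rel_def)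
  note 1 = div_hull_rel_cross[OF p, of q' q]
    and 2 = div_hull_rel_cross[OF q, of p' p, unfolded mult.commute[of "snd q'"] mult.commute[of "snd q"]]
  have "nsmul (snd q) (fst p) \<le> nsmul (snd p) (fst q) \<longleftrightarrow>
      nsmul (snd p' * snd q') (nsmul (snd q) (fst p)) \<le>
      nsmul (snd p' * snd q') (nsmul (snd p) (fst q))"
    using pos by (intro nsmul_le_iff[symmetric]) simp
  also have "\<dots> \<longleftrightarrow> nsmul (snd q') (fst p') \<le> nsmul (snd p') (fst q')"
    unfolding 1 2 using pos by (intro nsmul_le_iff) simp
  finally show "nsmul (snd q) (fst p) \<le> nsmul (snd p) (fst q) \<longleftrightarrow>
      nsmul (snd q') (fst p') \<le> nsmul (snd p') (fst q')" .
qed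

definition less_div_hull :: "'a div_hull \<Rightarrow> 'a div_hull \<Rightarrow> bool" where
  "x < y \<longleftrightarrow> x \<le> y \<and> \<not> y \<le> x" for x y :: "'a div_hull"

instance
proof
  fix x y z :: "'a div_hull"
  show "x + y + z = x + (y + z)"
    by transfer (auto simp: div_hull_rel_def nsmul_add mult_ac add_ac simp flip: nsmul_mult)
  show "x + y = y + x"
    by transfer (auto simp: div_hull_rel_def mult_ac add_ac)
  show "0 + x = x"
    by transfer (auto simp: div_hull_rel_def)
  show "- x + x = 0"
    by transfer (auto simp: div_hull_rel_def nsmul_uminus)
  show "x - y = x + - y"
    by (fact minus_div_hull_def)
  show "x < y \<longleftrightarrow> x \<le> y \<and> \<not> y \<le> x"
    by (fact less_div_hull_def)
  show "x \<le> x"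
    by transfer simp
  show "x \<le> y \<Longrightarrow> y \<le> x \<Longrightarrow> x = y"
    by transfer (auto simp: div_hull_rel_def)
  show "x \<le> y \<or> y \<le> x"
    by transfer auto
  show "x \<le> y \<Longrightarrow> y \<le> z \<Longrightarrow> x \<le> z"
  proof transfer
    fix p q r :: "'a \<times> nat"
    assume "div_hull_rel p p" "div_hull_rel q q" "div_hull_rel r r"
    then have pos: "0 < snd p" "0 < snd q" "0 < snd r"
      by (auto simp: div_hull_rel_def)
    assume pq: "nsmul (snd q) (fst p) \<le> nsmul (snd p) (fst q)"
      and qr: "nsmul (snd r) (fst q) \<le> nsmul (snd q) (fst r)"
    have "nsmul (snd q) (nsmul (snd r) (fst p)) = nsmul (snd r) (nsmul (snd q) (fst p))"
      by (rule nsmul_commute)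
    also have "\<dots> \<le> nsmul (snd r) (nsmul (snd p) (fst q))"
      using pq by (rule nsmul_mono)
    also have "\<dots> = nsmul (snd p) (nsmul (snd r) (fst q))"
      by (rule nsmul_commute)
    also have "\<dots> \<le> nsmul (snd p) (nsmul (snd q) (fst r))"
      using qr by (rule nsmul_mono)
    also have "\<dots> = nsmul (snd q) (nsmul (snd p) (fst r))"
      by (rule nsmul_commute)
    finally show "nsmul (snd r) (fst p) \<le> nsmul (snd p) (fst r)"
      using pos by simp
  qed
  show "x \<le> y \<Longrightarrow> z + x \<le> z + y"
  proof transfer
    fix p q r :: "'a \<times> nat"
    assume "div_hull_rel p p" "div_hull_rel q q" "div_hull_rel r r"
    then have pos: "0 < snd p" "0 < snd q" "0 < snd r"
      by (auto simp: div_hull_rel_def)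
    assume pq: "nsmul (snd q) (fst p) \<le> nsmul (snd p) (fst q)"
    have "nsmul (snd r * snd r) (nsmul (snd q) (fst p)) \<le> nsmul (snd r * snd r) (nsmul (snd p) (fst q))"
      using pq by (rule nsmul_mono)
    then show "nsmul (snd (nsmul (snd q) (fst r) + nsmul (snd r) (fst q), snd r * snd q))
          (fst (nsmul (snd p) (fst r) + nsmul (snd r) (fst p), snd r * snd p))
        \<le> nsmul (snd (nsmul (snd p) (fst r) + nsmul (snd r) (fst p), snd r * snd p))
          (fst (nsmul (snd q) (fst r) + nsmul (snd r) (fst q), snd r * snd q))"
      by (simp add: nsmul_add mult_ac flip: nsmul_mult)
  qed
qed

end

lift_definition to_div_hull :: "'a::linordered_ab_group_add \<Rightarrow> 'a div_hull" is "\<lambda>a. (a, 1)"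
  by (simp add: div_hull_rel_def)

lemma to_div_hull_zero: "to_div_hull 0 = 0"
  by transfer (simp add: div_hull_rel_def)

lemma to_div_hull_add: "to_div_hull (a + b) = to_div_hull a + to_div_hull b"
  by transfer (simp add: div_hull_rel_def)

lemma to_div_hull_le_iff: "to_div_hull a \<le> to_div_hull b \<longleftrightarrow> a \<le> b"
  by transfer simp

lemma to_div_hull_eq_iff: "to_div_hull a = to_div_hull b \<longleftrightarrow> a = b"
  by (metis order_antisym order_refl to_div_hull_le_iff)

lemma abs_div_hull_eqI: "div_hull_rel p q \<Longrightarrow> abs_div_hull p = abs_div_hull q"
  by (rule Quotient3_rel_abs[OF Quotient3_div_hull])

lemma abs_div_hull_cases:
  fixes d :: "'a::linordered_ab_group_add div_hull"
  obtains a m where "0 < m" "d = abs_div_hull (a, m)"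
proof -
  have "div_hull_rel (rep_div_hull d) (rep_div_hull d)"
    by (rule Quotient3_rep_reflp[OF Quotient3_div_hull])
  moreover have "d = abs_div_hull (rep_div_hull d)"
    by (rule Quotient3_abs_rep[OF Quotient3_div_hull, symmetric])
  ultimately show thesis
    using that[of "snd (rep_div_hull d)" "fst (rep_div_hull d)"] by (simp add: div_hull_rel_def)
qed

lemma nsmul_abs_div_hull:
  assumes "0 < m"
  shows "nsmul k (abs_div_hull (a, m)) = abs_div_hull (nsmul k a, m)"
proof (induction k)
  case 0
  show ?case
    using assms by (auto simp: zero_div_hull_def div_hull_rel_def intro: abs_div_hull_eqI)
next
  case (Suc k)
  have "nsmul (Suc k) (abs_div_hull (a, m)) = abs_div_hull (a, m) + abs_div_hull (nsmul k a, m)"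
    using Suc by simp
  also have "\<dots> = abs_div_hull (nsmul m a + nsmul m (nsmul k a), m * m)"
    using assms plus_div_hull.abs_eq[of "(a, m)" "(nsmul k a, m)"] by (simp add: div_hull_rel_def)
  also have "\<dots> = abs_div_hull (nsmul (Suc k) a, m)"
    using assms by (intro abs_div_hull_eqI) (simp add: div_hull_rel_def nsmul_add nsmul_mult)
  finally show ?case .
qed

lemma div_hull_torsion:
  fixes d :: "'a::linordered_ab_group_add div_hull"
  shows "\<exists>n>0. \<exists>a. nsmul n d = to_div_hull a"
proof -
  obtain a m where m: "0 < m" and d: "d = abs_div_hull (a, m)"
    by (rule abs_div_hull_cases)
  have "nsmul m d = to_div_hull a"
    unfolding d nsmul_abs_div_hull[OF m] to_div_hull_def
    using m by (auto simp: div_hull_rel_def intro: abs_div_hull_eqI)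
  with m show ?thesis by blast
qed

lemma div_hull_divisible:
  fixes d :: "'a::linordered_ab_group_add div_hull"
  assumes "0 < n"
  shows "\<exists>d'. nsmul n d' = d"
proof -
  obtain a m where m: "0 < m" and d: "d = abs_div_hull (a, m)"
    by (rule abs_div_hull_cases)
  have "nsmul n (abs_div_hull (a, n * m)) = abs_div_hull (nsmul n a, n * m)"
    using m assms by (intro nsmul_abs_div_hull) simp
  also have "\<dots> = d"
    unfolding d using m assms
    by (intro abs_div_hull_eqI) (simp add: div_hull_rel_def mult.commute flip: nsmul_mult)
  finally show ?thesis by blast
qed


section \<open>Valuations and quasi-valuations\<close>

locale finite_field_extension =
  fixes \<iota> :: "'f::field \<Rightarrow> 'e::field"
  assumes hom_one: "\<iota> 1 = 1"
    and hom_add: "\<iota> (a + b) = \<iota> a + \<iota> b"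
    and hom_mult: "\<iota> (a * b) = \<iota> a * \<iota> b"
    and finite_dim: "\<exists>B. finite_dimensional_vector_space (\<lambda>a x. \<iota> a * x) B"

definition valuation :: "('a::field \<Rightarrow> 'g::linordered_ab_group_add with_infty) \<Rightarrow> bool" where
  "valuation v \<longleftrightarrow>
    (\<forall>x. v x = Infty \<longleftrightarrow> x = 0) \<and>
    (\<forall>x y. v (x * y) = v x + v y) \<and>
    (\<forall>x y. min (v x) (v y) \<le> v (x + y))"

definition value_group :: "('a::field \<Rightarrow> 'g::linordered_ab_group_add with_infty) \<Rightarrow> 'g set" where
  "value_group v = {g. \<exists>x. x \<noteq> 0 \<and> v x = Fin g}"

definition quasi_valuation ::
    "('a::ring \<Rightarrow> 'm::{linorder, ordered_comm_monoid_add} with_infty) \<Rightarrow> bool" where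
  "quasi_valuation w \<longleftrightarrow>
    w 0 = Infty \<and>
    (\<forall>x y. w x + w y \<le> w (x * y)) \<and>
    (\<forall>x y. min (w x) (w y) \<le> w (x + y))"

definition exponential ::
    "('a::field \<Rightarrow> 'm::{linorder, ordered_comm_monoid_add} with_infty) \<Rightarrow> bool" where
  "exponential w \<longleftrightarrow> (\<forall>x m. w (x ^ m) = nsmul m (w x))"

inductive_set value_monoid :: "('a::field \<Rightarrow> 'm::comm_monoid_add with_infty) \<Rightarrow> 'm set"
  for w :: "'a \<Rightarrow> 'm with_infty" where
  generator: "x \<noteq> 0 \<Longrightarrow> w x = Fin m \<Longrightarrow> m \<in> value_monoid w"
| zero: "0 \<in> value_monoid w"
| add: "m \<in> value_monoid w \<Longrightarrow> n \<in> value_monoid w \<Longrightarrow> m + n \<in> value_monoid w"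

definition weakly_cancellative :: "'m::comm_monoid_add set \<Rightarrow> bool" where
  "weakly_cancellative S \<longleftrightarrow> (\<forall>a\<in>S. \<forall>b\<in>S. a + b = a \<longrightarrow> b = 0)"

definition qv_ring ::
    "('a::field \<Rightarrow> 'm::{linorder, ordered_comm_monoid_add} with_infty) \<Rightarrow> 'a set" where
  "qv_ring w = {x. 0 \<le> w x}"


section \<open>Extending a valuation\<close>

definition ordered_embedding_on ::
    "'m::{linorder, ordered_comm_monoid_add} set \<Rightarrow> ('m \<Rightarrow> 'n::{linorder, ordered_comm_monoid_add}) \<Rightarrow> bool"
where
  "ordered_embedding_on S j \<longleftrightarrow>
    j 0 = 0 \<and> (\<forall>a\<in>S. \<forall>b\<in>S. j (a + b) = j a + j b \<and> (j a \<le> j b \<longleftrightarrow> a \<le> b))"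

text \<open>
  \<open>extends_along j \<iota> v w\<close> reads \<open>w|\<^sub>F = v\<close> when \<open>F\<close> and the value group of \<open>v\<close> are
  identified with their images under \<open>\<iota>\<close> and \<open>j\<close>.
\<close>

definition extends_along ::
    "('g \<Rightarrow> 'm) \<Rightarrow> ('f \<Rightarrow> 'e) \<Rightarrow> ('f \<Rightarrow> 'g with_infty) \<Rightarrow> ('e \<Rightarrow> 'm with_infty) \<Rightarrow> bool" where
  "extends_along j \<iota> v w \<longleftrightarrow> (\<forall>a. w (\<iota> a) = map_with_infty j (v a))"

definition extends_valuation ::
    "('f::field \<Rightarrow> 'e::field) \<Rightarrow> ('f \<Rightarrow> 'g::linordered_ab_group_add with_infty)
      \<Rightarrow> ('e \<Rightarrow> 'm::{linorder, ordered_comm_monoid_add} with_infty) \<Rightarrow> bool" where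
  "extends_valuation \<iota> v w \<longleftrightarrow>
    (\<exists>j. ordered_embedding_on (value_group v) j \<and> extends_along j \<iota> v w)"

definition wc_quasi_extension ::
    "('f::field \<Rightarrow> 'e::field) \<Rightarrow> ('f \<Rightarrow> 'g::linordered_ab_group_add with_infty)
      \<Rightarrow> ('e \<Rightarrow> 'm::{linorder, ordered_comm_monoid_add} with_infty) \<Rightarrow> bool" where
  "wc_quasi_extension \<iota> v w \<longleftrightarrow>
    quasi_valuation w \<and> extends_valuation \<iota> v w \<and> weakly_cancellative (value_monoid w)"

text \<open>
  The totally ordered abelian monoid is arbitrary in the theory but cannot be bound inside a
  formula, so the set of quasi-valuation rings is indexed by the carrier type \<open>'m\<close> of the monoid.
  A statement about all quasi-valuation rings leaves \<open>'m\<close> as a type variable.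
\<close>

definition qv_rings ::
    "('f::field \<Rightarrow> 'e::field) \<Rightarrow> ('f \<Rightarrow> 'g::linordered_ab_group_add with_infty)
      \<Rightarrow> 'm::{linorder, ordered_comm_monoid_add} itself \<Rightarrow> 'e set set" where
  "qv_rings \<iota> v (_ :: 'm itself) =
    {qv_ring w | w :: 'e \<Rightarrow> 'm with_infty. wc_quasi_extension \<iota> v w}"


section \<open>Values in the divisible hull of the value group\<close>

text \<open>
  The value group of \<open>v\<close> need not be all of \<open>'g\<close>, so its divisible hull is the set of those
  elements of \<open>'g div_hull\<close> that are torsion over it.
\<close>

definition value_div_hull ::
    "('f::field \<Rightarrow> 'g::linordered_ab_group_add with_infty) \<Rightarrow> 'g div_hull set" where
  "value_div_hull v = {d. \<exists>n>0. nsmul n d \<in> to_div_hull ` value_group v}"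

definition hull_extension ::
    "('f::field \<Rightarrow> 'e::field) \<Rightarrow> ('f \<Rightarrow> 'g::linordered_ab_group_add with_infty)
      \<Rightarrow> ('e \<Rightarrow> 'g div_hull with_infty) \<Rightarrow> bool" where
  "hull_extension \<iota> v w \<longleftrightarrow>
    extends_along to_div_hull \<iota> v w \<and> (\<forall>x d. w x = Fin d \<longrightarrow> d \<in> value_div_hull v)"

text \<open>
  \<open>regarded_in_div_hull \<iota> v w w'\<close>: the function \<open>w'\<close> is \<open>w\<close> with its value monoid carried into
  the divisible hull by an order embedding over the value group of \<open>v\<close>.
\<close>

definition regarded_in_div_hull ::
    "('f::field \<Rightarrow> 'e::field) \<Rightarrow> ('f \<Rightarrow> 'g::linordered_ab_group_add with_infty)
      \<Rightarrow> ('e \<Rightarrow> 'm::{linorder, ordered_comm_monoid_add} with_infty)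
      \<Rightarrow> ('e \<Rightarrow> 'g div_hull with_infty) \<Rightarrow> bool" where
  "regarded_in_div_hull \<iota> v w w' \<longleftrightarrow>
    hull_extension \<iota> v w' \<and>
    (\<exists>e. ordered_embedding_on (value_monoid w) e \<and> (\<forall>x. w' x = map_with_infty e (w x)))"

text \<open>
  Exponential quasi-valuations are compared only after being regarded in the divisible hull, so
  the set of all of them is a set of functions into the divisible hull.
\<close>

definition exponential_extensions ::
    "('f::field \<Rightarrow> 'e::field) \<Rightarrow> ('f \<Rightarrow> 'g::linordered_ab_group_add with_infty)
      \<Rightarrow> ('e \<Rightarrow> 'g div_hull with_infty) set" where
  "exponential_extensions \<iota> v =
    {w. quasi_valuation w \<and> hull_extension \<iota> v w \<and> weakly_cancellative (value_monoid w) \<and>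
        exponential w}"


section \<open>Integral closure\<close>

definition integral_over :: "'a::field set \<Rightarrow> 'a \<Rightarrow> bool" where
  "integral_over R x \<longleftrightarrow>
    (\<exists>p. lead_coeff p = 1 \<and> (\<forall>i. coeff p i \<in> R) \<and> poly p x = 0)"

definition integral_closure :: "'a::field set \<Rightarrow> 'a set" where
  "integral_closure R = {x. integral_over R x}"

definition integrally_closed :: "'a::field set \<Rightarrow> bool" where
  "integrally_closed R \<longleftrightarrow> integral_closure R \<subseteq> R"

end

(*
  If w is exponential and x is integral over O_w with w x < 0, the integral equation gives
  n w(x) >= (n - 1) w(x), which weak cancellativity forbids.

  Conversely let R = O_w be integrally closed. Weak cancellativity makes 1 + a y a unit of R whenever
  v a > 0 and y is in R, so the maximal ideal of v generates an ideal inside the Jacobson radical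
  of R. For x outside R the element 1/x together with that ideal generates a proper ideal of R[1/x],
  and Chevalley's theorem gives a valuation ring of E that contains R, omits x, and meets F exactly
  in O_v. Hence R is the intersection of the valuation rings over O_v containing it. There are
  finitely many of these: being pairwise incomparable, they admit elements congruent to 1 modulo one
  maximal ideal and to 0 modulo the others, and such elements are linearly independent over F.
  Since E/F is algebraic, some positive power of each nonzero element of E agrees with an element
  of F up to a unit of such a ring, so the ring carries a valuation in the divisible hull.

  An exponential w with values in the divisible hull is determined by its ring: if n d = v c then
  d <= w x exactly when x^n / c lies in O_w. An arbitrary exponential w maps into the hull, because
  an algebraic equation for x has two terms of equal value, which makes w x torsion over the value
  group.
*)
theory Submission
  imports Defs
begin

section \<open>Subrings and valuation rings of a field\<close>

locale field_subring =
  fixes A :: "'a::field set"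
  assumes one_mem: "1 \<in> A"
    and diff_mem: "x \<in> A \<Longrightarrow> y \<in> A \<Longrightarrow> x - y \<in> A"
    and mult_mem: "x \<in> A \<Longrightarrow> y \<in> A \<Longrightarrow> x * y \<in> A"
begin

lemma zero_mem: "0 \<in> A"
  using diff_mem[OF one_mem one_mem] by simp

lemma uminus_mem: "x \<in> A \<Longrightarrow> - x \<in> A"
  using diff_mem[OF zero_mem] by simp

lemma add_mem: "x \<in> A \<Longrightarrow> y \<in> A \<Longrightarrow> x + y \<in> A"
  using diff_mem[OF _ uminus_mem] by simp

lemma power_mem: "x \<in> A \<Longrightarrow> x ^ n \<in> A"
  by (induction n) (auto intro: one_mem mult_mem)

lemma sum_mem: "(\<And>i. i \<in> S \<Longrightarrow> f i \<in> A) \<Longrightarrow> sum f S \<in> A"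
  by (induction S rule: infinite_finite_induct) (auto intro: zero_mem add_mem)

lemma prod_mem: "(\<And>i. i \<in> S \<Longrightarrow> f i \<in> A) \<Longrightarrow> prod f S \<in> A"
  by (induction S rule: infinite_finite_induct) (auto intro: one_mem mult_mem)

lemma poly_mem: "(\<And>i. coeff p i \<in> A) \<Longrightarrow> x \<in> A \<Longrightarrow> poly p x \<in> A"
  by (auto simp: poly_altdef intro: sum_mem mult_mem power_mem)

lemma coeff_mult_mem:
  "(\<And>i. coeff p i \<in> A) \<Longrightarrow> (\<And>i. coeff q i \<in> A) \<Longrightarrow> coeff (p * q) i \<in> A"
  by (auto simp: coeff_mult intro: sum_mem mult_mem)

lemma subset_integral_closure: "A \<subseteq> integral_closure A"
proof
  fix x assume x: "x \<in> A"
  have "coeff [:- x, 1:] i \<in> A" for i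
    using uminus_mem[OF x] one_mem zero_mem by (simp add: coeff_pCons split: nat.split)
  then show "x \<in> integral_closure A"
    unfolding integral_closure_def integral_over_def mem_Collect_eq
    by (intro exI[of _ "[:- x, 1:]"] conjI allI) simp_all
qed

end

text \<open>For a valuation ring this is the maximal ideal. The disjunct \<open>x = 0\<close> is
  explicit because \<open>inverse 0 = 0\<close> lies in the ring.\<close>

definition nonunits :: "'a::field set \<Rightarrow> 'a set" where
  "nonunits A = {x \<in> A. x = 0 \<or> inverse x \<notin> A}"

lemma nonunitsD: "x \<in> nonunits A \<Longrightarrow> x \<in> A"
  by (simp add: nonunits_def)

locale valuation_ring = field_subring A for A :: "'a::field set" +
  assumes total: "x \<in> A \<or> inverse x \<in> A"
begin

lemma inverse_nonunits: "x \<notin> A \<Longrightarrow> inverse x \<in> nonunits A"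
  using total[of x] by (auto simp: nonunits_def)

lemma zero_nonunits: "0 \<in> nonunits A"
  by (simp add: nonunits_def zero_mem)

lemma nonunits_mult:
  assumes "x \<in> nonunits A" "y \<in> A" shows "x * y \<in> nonunits A"
proof (cases "x * y = 0")
  case True
  then show ?thesis by (simp only: zero_nonunits)
next
  case False
  then have "inverse x = inverse (x * y) * y" by (simp add: mult.assoc)
  moreover have "inverse x \<notin> A" "x \<in> A"
    using assms(1) False by (auto simp: nonunits_def)
  ultimately have "inverse (x * y) \<notin> A"
    using mult_mem[OF _ assms(2), of "inverse (x * y)"] by metis
  with \<open>x \<in> A\<close> show ?thesis
    using mult_mem[OF _ assms(2)] by (simp add: nonunits_def del: inverse_mult_distrib)
qed

lemma nonunits_mult': "x \<in> A \<Longrightarrow> y \<in> nonunits A \<Longrightarrow> x * y \<in> nonunits A"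
  using nonunits_mult[of y x] by (simp add: mult.commute)

lemma one_notin_nonunits: "1 \<notin> nonunits A"
  by (simp add: nonunits_def one_mem)

lemma nonunits_uminus: "x \<in> nonunits A \<Longrightarrow> - x \<in> nonunits A"
  using nonunits_mult[of x "- 1"] by (simp add: one_mem uminus_mem)

text \<open>One of \<open>y / x\<close> and \<open>x / y\<close> lies in \<open>A\<close>, so a
  summand can be factored out: \<open>x + y = x * (1 + y / x)\<close>, or the same with
  \<open>x\<close> and \<open>y\<close> exchanged.\<close>

lemma nonunits_add:
  assumes x: "x \<in> nonunits A" and y: "y \<in> nonunits A" shows "x + y \<in> nonunits A"
proof -
  have *: "x + y \<in> nonunits A" if "x \<in> nonunits A" "x \<noteq> 0" "y / x \<in> A" for x y
  proof -
    have "x + y = x * (1 + y / x)" using that(2) by (simp add: distrib_left)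
    then show ?thesis using nonunits_mult[OF that(1) add_mem[OF one_mem that(3)]] by simp
  qed
  show ?thesis
  proof (cases "x = 0 \<or> y = 0")
    case False
    then show ?thesis
      using *[OF x, of y] *[OF y, of x] total[of "y / x"] by (auto simp: add.commute[of y x])
  qed (use x y in auto)
qed

lemma nonunits_sum:
  "(\<And>i. i \<in> S \<Longrightarrow> f i \<in> nonunits A) \<Longrightarrow> sum f S \<in> nonunits A"
  by (induction S rule: infinite_finite_induct) (auto intro: nonunits_add zero_nonunits)

lemma nonunits_power: "x \<in> nonunits A \<Longrightarrow> 0 < n \<Longrightarrow> x ^ n \<in> nonunits A"
  using nonunits_mult[of x "x ^ (n - 1)"] by (cases n) (auto intro: power_mem dest: nonunitsD)

text \<open>A valuation ring contains the roots of its elements: for \<open>x\<close> outside,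
  \<open>inverse x\<close> is a nonunit, and then \<open>1 = x ^ n * inverse x ^ n\<close> would be
  one too.\<close>

lemma power_mem_iff: "0 < n \<Longrightarrow> x ^ n \<in> A \<longleftrightarrow> x \<in> A"
proof (intro iffI power_mem, rule ccontr)
  assume n: "0 < n" and xn: "x ^ n \<in> A" and x: "x \<notin> A"
  have "x ^ n * inverse x ^ n \<in> nonunits A"
    using n x xn by (intro nonunits_mult' nonunits_power inverse_nonunits)
  moreover have "x \<noteq> 0" using x zero_mem by auto
  ultimately show False
    using one_notin_nonunits by (simp add: power_inverse)
qed

lemma one_add_nonunits: "x \<in> nonunits A \<Longrightarrow> 1 + x \<notin> nonunits A"
  using nonunits_add[OF _ nonunits_uminus, of "1 + x" x] one_notin_nonunits by auto

lemma unit_inverse_mem: "x \<in> A \<Longrightarrow> x \<notin> nonunits A \<Longrightarrow> inverse x \<in> A"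
  by (auto simp: nonunits_def)

text \<open>Elements congruent to 1 are units, and
  \<open>inverse x - 1 = - (inverse x * (x - 1))\<close> keeps the congruence.\<close>

lemma inverse_sub_one_nonunits:
  assumes "x - 1 \<in> nonunits A"
  shows "inverse x \<in> A" "inverse x - 1 \<in> nonunits A" "x \<noteq> 0"
proof -
  have x: "x \<in> A" "x \<notin> nonunits A"
    using one_add_nonunits[OF assms] add_mem[OF one_mem nonunitsD[OF assms]] by simp_all
  then show ix: "inverse x \<in> A" by (rule unit_inverse_mem)
  show nz: "x \<noteq> 0" using assms nonunits_uminus[of "- 1"] one_notin_nonunits by auto
  have "inverse x - 1 = - (inverse x * (x - 1))" using nz by (simp add: algebra_simps)
  then show "inverse x - 1 \<in> nonunits A"
    using nonunits_uminus[OF nonunits_mult'[OF ix assms]] by simp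
qed

lemma poly_sub_one_nonunits:
  assumes "\<And>i. coeff p i \<in> A" "coeff p 0 = 1" "x \<in> nonunits A"
  shows "poly p x - 1 \<in> nonunits A"
proof -
  obtain q where q: "p = pCons 1 q" using assms(2) by (cases p) auto
  have "coeff q i \<in> A" for i using assms(1)[of "Suc i"] q by simp
  then have "x * poly q x \<in> nonunits A"
    using assms(3) by (intro nonunits_mult poly_mem) (auto dest: nonunitsD)
  then show ?thesis by (simp add: q)
qed

end

section \<open>Chevalley's extension theorem\<close>

text \<open>Ring and ideal are bundled because Zorn's lemma will enlarge both at once.\<close>

locale proper_ideal = field_subring A for A :: "'a::field set" +
  fixes I :: "'a set"
  assumes ideal_subset: "I \<subseteq> A"
    and ideal_zero: "0 \<in> I"
    and ideal_add: "x \<in> I \<Longrightarrow> y \<in> I \<Longrightarrow> x + y \<in> I"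
    and ideal_mult: "x \<in> A \<Longrightarrow> y \<in> I \<Longrightarrow> x * y \<in> I"
    and one_notin_ideal: "1 \<notin> I"
begin

lemma ideal_mult': "x \<in> I \<Longrightarrow> y \<in> A \<Longrightarrow> x * y \<in> I"
  using ideal_mult[of y x] by (simp add: mult.commute)

lemma ideal_uminus: "x \<in> I \<Longrightarrow> - x \<in> I"
  using ideal_mult[of "- 1" x] by (simp add: one_mem uminus_mem)

lemma ideal_diff: "x \<in> I \<Longrightarrow> y \<in> I \<Longrightarrow> x - y \<in> I"
  using ideal_add[OF _ ideal_uminus, of x y] by simp

text \<open>The new ideal is \<open>I + z K[z]\<close> inside \<open>A[z]\<close>. With
  \<open>K = I\<close> it is the extension of \<open>I\<close>, as used in Chevalley's theorem; with
  \<open>K = A\<close> it is generated by \<open>I\<close> and \<open>z\<close>, as used to turn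
  \<open>z\<close> into a nonunit.\<close>

lemma adjoin_proper_ideal:
  assumes K: "I \<subseteq> K" "K \<subseteq> A" "\<And>x y. x \<in> K \<Longrightarrow> y \<in> K \<Longrightarrow> x + y \<in> K"
      "\<And>x y. x \<in> A \<Longrightarrow> y \<in> K \<Longrightarrow> x * y \<in> K"
    and proper: "\<nexists>p. coeff p 0 \<in> I \<and> (\<forall>i. coeff p i \<in> K) \<and> poly p z = 1"
  shows "proper_ideal {poly p z | p. \<forall>i. coeff p i \<in> A}
    {poly p z | p. coeff p 0 \<in> I \<and> (\<forall>i. coeff p i \<in> K)}" (is "proper_ideal ?A ?I")
proof
  have K_sum: "(\<And>i. i \<in> S \<Longrightarrow> f i \<in> K) \<Longrightarrow> sum f S \<in> K" for S :: "nat set" and f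
    using K(1) ideal_zero by (induction S rule: infinite_finite_induct) (auto intro: K(3))
  show "1 \<in> ?A"
    by (auto intro!: exI[of _ 1] simp: one_mem zero_mem)
  show "0 \<in> ?I"
    using K(1) ideal_zero by (auto intro!: exI[of _ 0])
  show "?I \<subseteq> ?A"
    using K(2) by blast
  show "1 \<notin> ?I"
    using proper by auto
  show "x + y \<in> ?I" if "x \<in> ?I" "y \<in> ?I" for x y
  proof -
    from that obtain p q where "x = poly p z" "y = poly q z" "\<forall>i. coeff p i \<in> K"
      "\<forall>i. coeff q i \<in> K" "coeff p 0 \<in> I" "coeff q 0 \<in> I"
      by auto
    then show ?thesis
      by (auto intro!: exI[of _ "p + q"] simp: ideal_add K(3))
  qed
  show "x * y \<in> ?I" if "x \<in> ?A" "y \<in> ?I" for x y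
  proof -
    from that obtain p q where "x = poly p z" "y = poly q z" "\<forall>i. coeff p i \<in> A"
      "\<forall>i. coeff q i \<in> K" "coeff q 0 \<in> I"
      by auto
    then show ?thesis
      by (auto intro!: exI[of _ "p * q"] K_sum K(4) simp: coeff_mult ideal_mult)
  qed
  fix x y assume "x \<in> ?A" "y \<in> ?A"
  then obtain p q where pq: "x = poly p z" "y = poly q z" "\<forall>i. coeff p i \<in> A" "\<forall>i. coeff q i \<in> A"
    by auto
  then show "x - y \<in> ?A"
    by (auto intro!: exI[of _ "p - q"] simp: diff_mem)
  show "x * y \<in> ?A"
    using pq by (auto intro!: exI[of _ "p * q"] sum_mem mult_mem simp: coeff_mult)
qed

text \<open>The relation at \<open>inverse z\<close>, multiplied by a power of \<open>z\<close>,
  expresses \<open>(1 - coeff q 0) * z ^ n\<close> through lower powers of \<open>z\<close>; this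
  replaces the top term of \<open>p\<close>.\<close>

lemma reduce_degree:
  assumes p: "\<And>i. coeff p i \<in> I" "poly p z = 1"
    and q: "\<And>i. coeff q i \<in> I" "poly q (inverse z) = 1"
    and le: "degree q \<le> degree p" and z: "z \<noteq> 0"
  obtains s where "\<And>i. coeff s i \<in> I" "poly s z = 1" "degree s < degree p"
proof -
  define n where "n = degree p"
  have n: "0 < n"
  proof (rule ccontr)
    assume "\<not> 0 < n"
    then obtain c where "p = [:c:]" unfolding n_def by (metis degree_eq_zeroE not_gr_zero)
    then show False using p(1)[of 0] p(2) one_notin_ideal by simp
  qed
  \<comment> \<open>The reflected polynomial shifted to degree \<open>n\<close> has the value
    \<open>z ^ n\<close> at \<open>z\<close> and the coefficient \<open>coeff q 0\<close> in degree
    \<open>n\<close>, which the subtracted monomial cancels.\<close>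
  define r where "r = monom 1 (n - degree q) * reflect_poly q - monom (coeff q 0) n"
  have zn: "z ^ n = z ^ (n - degree q) * z ^ degree q"
    using le by (simp add: n_def flip: power_add)
  have r_poly: "poly r z = (1 - coeff q 0) * z ^ n"
    using z q(2) by (simp add: r_def poly_monom poly_reflect_poly_nz zn algebra_simps)
  have r_coeff: "coeff r i \<in> I" for i
    unfolding r_def coeff_diff coeff_monom_mult
    by (auto intro!: ideal_diff simp: q(1) ideal_zero coeff_reflect_poly)
  have r_high: "coeff r i = 0" if "i \<ge> n" for i
    using that le by (auto simp: r_def coeff_monom_mult coeff_reflect_poly n_def)
  \<comment> \<open>As \<open>1 - coeff q 0\<close> need not be invertible in \<open>A\<close>, the
    lower part of \<open>p\<close> is multiplied by it instead of dividing \<open>r\<close>; the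
    constant \<open>coeff q 0\<close> restores the value 1.\<close>
  define s where "s = smult (1 - coeff q 0) (p - monom (coeff p n) n) + smult (coeff p n) r + [:coeff q 0:]"
  have "coeff s i \<in> I" for i
    unfolding s_def coeff_add coeff_smult coeff_diff
    using p(1) q(1) ideal_subset
    by (intro ideal_add ideal_mult ideal_diff diff_mem one_mem)
       (auto simp: coeff_pCons r_coeff ideal_zero split: nat.splits)
  moreover have "poly s z = 1"
    by (simp add: s_def r_poly p(2) poly_monom algebra_simps)
  moreover have "degree s < n"
  proof (rule degree_lessI)
    show "\<forall>k\<ge>n. coeff s k = 0"
    proof safe
      fix k assume "n \<le> k"
      then show "coeff s k = 0"
        using n coeff_eq_0[of p k]
        by (cases "n = k") (auto simp: s_def r_high coeff_pCons n_def[symmetric] split: nat.splits)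
    qed
  qed (use n in simp)
  ultimately show thesis using that n_def by blast
qed

text \<open>If \<open>I\<close> generated the unit ideal in both \<open>A[z]\<close> and
  \<open>A[1/z]\<close>, the relation of larger degree could always be lowered by means of the
  other, an infinite descent on the sum of the degrees.\<close>

lemma ideal_stays_proper:
  assumes "z \<noteq> 0" "\<And>i. coeff p i \<in> I" "poly p z = 1" "\<And>i. coeff q i \<in> I"
  shows "poly q (inverse z) \<noteq> 1"
proof
  assume "poly q (inverse z) = 1"
  with assms show False
  proof (induction "degree p + degree q" arbitrary: p q z rule: less_induct)
    case less
    show False
    proof (cases "degree q \<le> degree p")
      case True
      obtain s where "\<And>i. coeff s i \<in> I" "poly s z = 1" "degree s < degree p"
        using reduce_degree[of p z q] less.prems True by blast
      with less.hyps[of s q z] less.prems show False by auto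
    next
      case False
      obtain s where "\<And>i. coeff s i \<in> I" "poly s (inverse z) = 1" "degree s < degree q"
        using reduce_degree[of q "inverse z" p] less.prems False by auto
      with less.hyps[of p s z] less.prems show False by auto
    qed
  qed
qed

end

text \<open>In a maximal pair \<open>(V, J)\<close>, any \<open>z\<close> for which \<open>J\<close>
  stays proper in \<open>V[z]\<close> already lies in \<open>V\<close>, and
  \<open>ideal_stays_proper\<close> shows that \<open>z\<close> or \<open>inverse z\<close> is of
  this kind.\<close>

theorem chevalley_extension:
  assumes "proper_ideal A I"
  obtains V where "valuation_ring V" "A \<subseteq> V" "I \<subseteq> nonunits V"
proof -
  \<comment> \<open>A subring and an ideal are encoded as one set, so that Zorn's lemma for inclusion applies.\<close>
  let ?ring = "\<lambda>Z :: ('a \<times> bool) set. {x. (x, True) \<in> Z}"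
  let ?ideal = "\<lambda>Z :: ('a \<times> bool) set. {x. (x, False) \<in> Z}"
  define P where "P Z \<longleftrightarrow> proper_ideal (?ring Z) (?ideal Z)" for Z
  define Z0 where "Z0 = A \<times> {True} \<union> I \<times> {False}"
  have P0: "P Z0" using assms by (simp add: P_def Z0_def)
  let ?Z = "{Z. P Z \<and> Z0 \<subseteq> Z}"
  have "\<exists>M\<in>?Z. \<forall>X\<in>?Z. M \<subseteq> X \<longrightarrow> X = M"
  proof (rule subset_Zorn_nonempty)
    show "?Z \<noteq> {}" using P0 by auto
  next
    fix C assume C: "C \<noteq> {}" "subset.chain ?Z C"
    have pi: "proper_ideal (?ring Z) (?ideal Z)" if "Z \<in> C" for Z
      using C that by (auto simp: subset_chain_def P_def)
    have common: "\<exists>Z\<in>C. s \<in> Z \<and> t \<in> Z" if "s \<in> \<Union>C" "t \<in> \<Union>C" for s t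
      using that C(2) unfolding subset_chain_def by blast
    have "P (\<Union>C)" unfolding P_def
    proof
      show "1 \<in> ?ring (\<Union>C)"
        using C(1) field_subring.one_mem[OF proper_ideal.axioms(1)[OF pi]] by blast
      show "0 \<in> ?ideal (\<Union>C)"
        using C(1) proper_ideal.ideal_zero[OF pi] by blast
      show "?ideal (\<Union>C) \<subseteq> ?ring (\<Union>C)"
        using proper_ideal.ideal_subset[OF pi] by blast
      show "1 \<notin> ?ideal (\<Union>C)"
        using proper_ideal.one_notin_ideal[OF pi] by blast
    next
      fix x y assume "x \<in> ?ring (\<Union>C)" "y \<in> ?ring (\<Union>C)"
      then obtain Z where Z: "Z \<in> C" "x \<in> ?ring Z" "y \<in> ?ring Z"
        using common[of "(x, True)" "(y, True)"] by auto
      show "x - y \<in> ?ring (\<Union>C)" "x * y \<in> ?ring (\<Union>C)"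
        using Z(1) field_subring.diff_mem[OF proper_ideal.axioms(1)[OF pi] Z(2,3)]
          field_subring.mult_mem[OF proper_ideal.axioms(1)[OF pi] Z(2,3)] by blast+
    next
      fix x y assume "x \<in> ?ideal (\<Union>C)" "y \<in> ?ideal (\<Union>C)"
      then obtain Z where Z: "Z \<in> C" "x \<in> ?ideal Z" "y \<in> ?ideal Z"
        using common[of "(x, False)" "(y, False)"] by auto
      show "x + y \<in> ?ideal (\<Union>C)"
        using Z(1) proper_ideal.ideal_add[OF pi Z(2,3)] by blast
    next
      fix x y assume "x \<in> ?ring (\<Union>C)" "y \<in> ?ideal (\<Union>C)"
      then obtain Z where Z: "Z \<in> C" "x \<in> ?ring Z" "y \<in> ?ideal Z"
        using common[of "(x, True)" "(y, False)"] by auto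
      show "x * y \<in> ?ideal (\<Union>C)"
        using Z(1) proper_ideal.ideal_mult[OF pi Z(2,3)] by blast
    qed
    moreover have "Z0 \<subseteq> \<Union>C" using C unfolding subset_chain_def by blast
    ultimately show "\<Union>C \<in> ?Z" by simp
  qed
  then obtain M where M: "P M" "Z0 \<subseteq> M" and maximal: "\<And>X. P X \<Longrightarrow> M \<subseteq> X \<Longrightarrow> X = M"
    by auto
  define V J where "V = ?ring M" and "J = ?ideal M"
  interpret M: proper_ideal V J using M(1) by (simp add: P_def V_def J_def)
  have mem: "z \<in> V" if "\<nexists>p. (\<forall>i. coeff p i \<in> J) \<and> poly p z = 1" for z
  proof -
    define A' I' where "A' = {poly p z | p. \<forall>i. coeff p i \<in> V}"
      and "I' = {poly p z | p. coeff p 0 \<in> J \<and> (\<forall>i. coeff p i \<in> J)}"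
    define M' where "M' = A' \<times> {True} \<union> I' \<times> {False}"
    have "P M'" using M.adjoin_proper_ideal[OF order_refl M.ideal_subset M.ideal_add M.ideal_mult, of z] that
      by (simp add: P_def M'_def A'_def I'_def)
    moreover have "V \<subseteq> A'"
    proof
      fix x assume "x \<in> V"
      then show "x \<in> A'" unfolding A'_def
        by (auto intro!: exI[of _ "[:x:]"] simp: coeff_pCons M.zero_mem split: nat.splits)
    qed
    moreover have "J \<subseteq> I'"
    proof
      fix x assume "x \<in> J"
      then show "x \<in> I'" unfolding I'_def
        by (auto intro!: exI[of _ "[:x:]"] simp: coeff_pCons M.ideal_zero split: nat.splits)
    qed
    moreover have "M \<subseteq> M'"
    proof
      fix t assume "t \<in> M"
      with \<open>V \<subseteq> A'\<close> \<open>J \<subseteq> I'\<close> show "t \<in> M'"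
        by (cases t; cases "snd t") (auto simp: M'_def V_def J_def)
    qed
    ultimately have "M' = M" using maximal by blast
    moreover have "z \<in> A'" unfolding A'_def
      by (auto intro!: exI[of _ "[:0, 1:]"] simp: coeff_pCons M.zero_mem M.one_mem split: nat.splits)
    ultimately show "z \<in> V" by (auto simp: V_def M'_def)
  qed
  have "valuation_ring V"
  proof
    fix z show "z \<in> V \<or> inverse z \<in> V"
    proof (cases "z = 0")
      case False
      then show ?thesis using mem[of z] mem[of "inverse z"] M.ideal_stays_proper[of z] by blast
    qed (simp add: M.zero_mem)
  qed
  moreover have "A \<subseteq> V" using M(2) by (auto simp: Z0_def V_def)
  moreover have "I \<subseteq> nonunits V"
  proof
    fix x assume "x \<in> I"
    then have x: "x \<in> J" using M(2) by (auto simp: Z0_def J_def)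
    moreover have "inverse x \<notin> V" if "x \<noteq> 0"
      using M.ideal_mult'[OF x, of "inverse x"] that M.one_notin_ideal by auto
    ultimately show "x \<in> nonunits V" using M.ideal_subset by (auto simp: nonunits_def)
  qed
  ultimately show thesis by (rule that)
qed

section \<open>Independence of finitely many valuation rings\<close>

context valuation_ring
begin

lemma prod_sub_one_nonunits:
  assumes "finite S" "\<And>i. i \<in> S \<Longrightarrow> f i - 1 \<in> nonunits A"
  shows "prod f S - 1 \<in> nonunits A"
  using assms
proof (induction S rule: finite_induct)
  case (insert i S)
  then have IH: "prod f S - 1 \<in> nonunits A" by simp
  then have "prod f S \<in> A" using add_mem[OF one_mem nonunitsD] by fastforce
  then have "(f i - 1) * prod f S + (prod f S - 1) \<in> nonunits A"
    using insert.prems IH by (intro nonunits_add nonunits_mult) auto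
  then show ?case using insert.hyps by (simp add: algebra_simps)
qed (simp add: zero_nonunits)

text \<open>\<open>poly f q\<close> is \<open>q ^ degree f\<close> times the reflected polynomial at
  \<open>inverse q\<close>. The second factor is congruent to 1 because \<open>f\<close> is monic,
  so the power of \<open>q\<close> alone decides.\<close>

lemma inverse_poly_nonunits:
  assumes f: "\<And>i. coeff f i \<in> A" "lead_coeff f = 1" "0 < degree f" and q: "q \<notin> A"
  shows "inverse (poly f q) \<in> nonunits A"
proof -
  have q0: "q \<noteq> 0" and q': "inverse q \<in> nonunits A"
    using q zero_mem by (auto simp: inverse_nonunits)
  have "poly (reflect_poly f) (inverse q) - 1 \<in> nonunits A"
    using f q' by (intro poly_sub_one_nonunits) (auto simp: coeff_reflect_poly zero_mem)
  then have "inverse (poly (reflect_poly f) (inverse q)) \<in> A"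
    by (rule inverse_sub_one_nonunits)
  moreover have "inverse (poly f q) = inverse q ^ degree f * inverse (poly (reflect_poly f) (inverse q))"
    using q0 by (simp add: poly_reflect_poly_nz power_inverse)
  ultimately show ?thesis
    using f(3) q' by (metis nonunits_mult nonunits_power)
qed

end

text \<open>
  Adding \<open>1\<close> to \<open>X\<close> times a product of polynomials of the same shape makes the value at \<open>q\<close> a unit
  wherever some polynomial of this shape vanishes at \<open>q\<close> modulo the maximal ideal, and everywhere
  else it is a unit automatically.
\<close>

lemma ex_poly_inverse_mem:
  assumes "finite S" and vr: "\<And>V. V \<in> S \<Longrightarrow> valuation_ring V"
  obtains f where "lead_coeff f = 1" "coeff f 0 = 1" "0 < degree f"
    "\<And>V i. V \<in> S \<Longrightarrow> coeff f i \<in> V" "\<And>V. V \<in> S \<Longrightarrow> inverse (poly f q) \<in> V"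
proof -
  define good where "good f \<longleftrightarrow> lead_coeff f = 1 \<and> coeff f 0 = 1 \<and> (\<forall>V\<in>S. \<forall>i. coeff f i \<in> V)" for f
  have sr: "field_subring V" if "V \<in> S" for V
    using vr[OF that] by (rule valuation_ring.axioms)
  have good_mult: "good (f * g)" if "good f" "good g" for f g
    using that field_subring.coeff_mult_mem[OF sr, of _ f g]
    by (auto simp: good_def coeff_mult_0 lead_coeff_mult)
  \<comment> \<open>Multiplying one witness per ring gives a single good polynomial that is a
    nonunit at \<open>q\<close> for every ring of \<open>T\<close> containing \<open>q\<close> where
    some good polynomial is.\<close>
  have ex: "\<exists>f. good f \<and> (\<forall>V\<in>T. q \<in> V \<longrightarrow> (\<exists>g. good g \<and> poly g q \<in> nonunits V) \<longrightarrow> poly f q \<in> nonunits V)"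
    if "T \<subseteq> S" for T
    using finite_subset[OF that \<open>finite S\<close>] that
  proof (induction T rule: finite_induct)
    case empty
    have "good 1"
      by (auto simp: good_def sr field_subring.one_mem field_subring.zero_mem)
    then show ?case by auto
  next
    case (insert V T)
    then obtain f where f: "good f"
      "\<And>V. V \<in> T \<Longrightarrow> q \<in> V \<Longrightarrow> \<exists>g. good g \<and> poly g q \<in> nonunits V \<Longrightarrow> poly f q \<in> nonunits V"
      by blast
    have V: "V \<in> S" using insert.prems by simp
    show ?case
    proof (cases "\<exists>g. good g \<and> poly g q \<in> nonunits V")
      case True
      then obtain g where g: "good g" "poly g q \<in> nonunits V" by blast
      have "poly (f * g) q \<in> nonunits W"
        if W: "W \<in> insert V T" "q \<in> W" "\<exists>g. good g \<and> poly g q \<in> nonunits W" for W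
      proof -
        have "W \<in> S" using W(1) insert.prems by auto
        interpret W: valuation_ring W using vr[OF \<open>W \<in> S\<close>] .
        have "poly f q \<in> W" "poly g q \<in> W"
          using f(1) g(1) \<open>W \<in> S\<close> W(2) by (auto simp: good_def intro: W.poly_mem)
        then show ?thesis
          using W f(2)[of W] g(2) W.nonunits_mult[of "poly f q" "poly g q"]
            W.nonunits_mult'[of "poly f q" "poly g q"] by auto
      qed
      then show ?thesis using good_mult[OF f(1) g(1)] by blast
    next
      case False
      then show ?thesis using f by blast
    qed
  qed
  obtain p where p: "good p"
    "\<forall>V\<in>S. q \<in> V \<longrightarrow> (\<exists>g. good g \<and> poly g q \<in> nonunits V) \<longrightarrow> poly p q \<in> nonunits V"
    using ex[OF order_refl] by (elim exE conjE) (rule that)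
  define f where "f = pCons 1 p"
  have "p \<noteq> 0" using p(1) by (auto simp: good_def)
  then have deg: "0 < degree f" by (simp add: f_def)
  have f: "good f"
    using p(1) \<open>p \<noteq> 0\<close> field_subring.one_mem[OF sr]
    by (auto simp: good_def f_def coeff_pCons split: nat.split)
  have "inverse (poly f q) \<in> V" if V: "V \<in> S" for V
  proof -
    interpret V: valuation_ring V using vr[OF V] .
    show ?thesis
    proof (cases "q \<in> V")
      case True
      \<comment> \<open>Otherwise \<open>f\<close> itself is a good witness, so
        \<open>poly p q\<close> is a nonunit; but then \<open>poly f q = 1 + q * poly p q\<close> is
        a unit.\<close>
      have "poly f q \<notin> nonunits V"
      proof
        assume "poly f q \<in> nonunits V"
        then have "q * poly p q \<in> nonunits V"
          using p(2) V True f by (intro V.nonunits_mult') blast+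
        then show False
          using V.one_add_nonunits \<open>poly f q \<in> nonunits V\<close> by (auto simp: f_def)
      qed
      moreover have "poly f q \<in> V"
        using f V True by (auto simp: good_def intro: V.poly_mem)
      ultimately show ?thesis by (intro V.unit_inverse_mem)
    next
      case False
      then show ?thesis
        using V.inverse_poly_nonunits[OF _ _ deg] f V by (auto simp: good_def dest: nonunitsD)
    qed
  qed
  with f deg show thesis by (auto simp: good_def intro: that)
qed

text \<open>For \<open>a\<close> in \<open>V\<close> but not \<open>W\<close> and \<open>b\<close>
  in \<open>W\<close> but not \<open>V\<close>, the quotient \<open>q = a / b\<close> is a nonunit
  at \<open>V\<close> and lies outside \<open>W\<close>. With \<open>f\<close> from
  \<open>ex_poly_inverse_mem\<close>, \<open>inverse (poly f q)\<close> is congruent to 1 at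
  \<open>V\<close>, a nonunit at \<open>W\<close> and integral everywhere in
  \<open>S\<close>.\<close>

lemma ex_pairwise_separating:
  assumes "finite S" and vr: "\<And>V. V \<in> S \<Longrightarrow> valuation_ring V"
    and V: "V \<in> S" "W \<in> S" "\<not> V \<subseteq> W" "\<not> W \<subseteq> V"
  obtains x where "x - 1 \<in> nonunits V" "x \<in> nonunits W" "\<And>U. U \<in> S \<Longrightarrow> x \<in> U"
proof -
  interpret V: valuation_ring V using vr[OF V(1)] .
  interpret W: valuation_ring W using vr[OF V(2)] .
  obtain a b where a: "a \<in> V" "a \<notin> W" and b: "b \<in> W" "b \<notin> V" using V(3,4) by blast
  have nz: "a \<noteq> 0" "b \<noteq> 0" using a b V.zero_mem W.zero_mem by auto
  define q where "q = a * inverse b"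
  have qV: "q \<in> nonunits V"
    unfolding q_def using a b by (intro V.nonunits_mult' V.inverse_nonunits)
  have "inverse q = b * inverse a" by (simp add: q_def)
  also have "\<dots> \<in> nonunits W"
    using a b by (intro W.nonunits_mult' W.inverse_nonunits)
  finally have qW: "q \<notin> W"
    using nz by (simp add: nonunits_def q_def)
  obtain f where f: "lead_coeff f = 1" "coeff f 0 = 1" "0 < degree f"
    "\<And>V i. V \<in> S \<Longrightarrow> coeff f i \<in> V" "\<And>V. V \<in> S \<Longrightarrow> inverse (poly f q) \<in> V"
    by (rule ex_poly_inverse_mem[OF assms(1) vr, of q]) (assumption, (rule that; blast))
  have "inverse (poly f q) - 1 \<in> nonunits V"
    using f(2,4) V(1) qV by (intro V.inverse_sub_one_nonunits V.poly_sub_one_nonunits) auto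
  moreover have "inverse (poly f q) \<in> nonunits W"
    using f V(2) qW by (intro W.inverse_poly_nonunits) auto
  ultimately show thesis using f(5) that by blast
qed

text \<open>The product of the pairwise separating elements works: they are integral at all rings of
  \<open>S\<close>, so the remaining factors cannot destroy the vanishing at
  \<open>W\<close>.\<close>

lemma ex_separating:
  assumes "finite S" and vr: "\<And>V. V \<in> S \<Longrightarrow> valuation_ring V"
    and incomparable: "\<And>V W. V \<in> S \<Longrightarrow> W \<in> S \<Longrightarrow> V \<subseteq> W \<Longrightarrow> V = W"
    and V: "V \<in> S"
  shows "\<exists>x. x - 1 \<in> nonunits V \<and> (\<forall>W\<in>S - {V}. x \<in> nonunits W)"
proof -
  have "\<exists>x. x - 1 \<in> nonunits V \<and> x \<in> nonunits W \<and> (\<forall>U\<in>S. x \<in> U)" if "W \<in> S - {V}" for W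
  proof -
    have "W \<in> S" "\<not> V \<subseteq> W" "\<not> W \<subseteq> V"
      using that incomparable[OF V, of W] incomparable[of W V] V by auto
    then obtain x where "x - 1 \<in> nonunits V" "x \<in> nonunits W" "\<And>U. U \<in> S \<Longrightarrow> x \<in> U"
      using ex_pairwise_separating[OF assms(1,2) V] by metis
    then show ?thesis by blast
  qed
  then obtain x where x: "\<And>W. W \<in> S - {V} \<Longrightarrow> x W - 1 \<in> nonunits V"
    "\<And>W. W \<in> S - {V} \<Longrightarrow> x W \<in> nonunits W" "\<And>W U. W \<in> S - {V} \<Longrightarrow> U \<in> S \<Longrightarrow> x W \<in> U"
    by metis
  interpret V: valuation_ring V using vr[OF V] .
  have "prod x (S - {V}) - 1 \<in> nonunits V"
    using assms(1) x(1) by (intro V.prod_sub_one_nonunits) auto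
  moreover have "prod x (S - {V}) \<in> nonunits W" if W: "W \<in> S - {V}" for W
  proof -
    interpret W: valuation_ring W using vr W by auto
    have "prod x (S - {V}) = x W * prod x (S - {V} - {W})"
      using assms(1) W by (intro prod.remove) auto
    moreover have "prod x (S - {V} - {W}) \<in> W"
      using W x(3) by (intro W.prod_mem) auto
    ultimately show ?thesis using x(2)[OF W] by (simp add: W.nonunits_mult)
  qed
  ultimately show ?thesis by blast
qed

section \<open>Dominant terms of vanishing sums\<close>

text \<open>\<open>le x y\<close> reads as an ultrametric size comparison. A strictly dominant term
  would be minus a sum of strictly smaller terms, hence strictly smaller than itself. Since
  \<open>le\<close> is only a preorder, the two dominant terms are equivalent, not equal.\<close>

lemma two_dominant_terms:
  fixes le :: "'a::ab_group_add \<Rightarrow> 'a \<Rightarrow> bool" and t :: "'i \<Rightarrow> 'a"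
  assumes total: "\<And>x y. le x y \<or> le y x"
    and trans: "\<And>x y z. le x y \<Longrightarrow> le y z \<Longrightarrow> le x z"
    and add: "\<And>x y z. le x z \<Longrightarrow> le y z \<Longrightarrow> le (x + y) z"
    and uminus: "\<And>x. le (- x) x"
    and S: "finite S" "S \<noteq> {}" and sum: "sum t S = 0" and nz: "\<And>i. i \<in> S \<Longrightarrow> \<not> le (t i) 0"
  shows "\<exists>i\<in>S. \<exists>j\<in>S. i \<noteq> j \<and> le (t i) (t j) \<and> le (t j) (t i)"
proof -
  have "\<exists>j\<in>S. \<forall>i\<in>S. le (t i) (t j)"
    using S
  proof (induction S rule: finite_ne_induct)
    case (singleton i)
    then show ?case using total by blast
  next
    case (insert i S)
    then show ?case using total trans by (metis insert_iff)
  qed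
  then obtain j where j: "j \<in> S" "\<And>i. i \<in> S \<Longrightarrow> le (t i) (t j)" by blast
  \<comment> \<open>The strict ultrametric inequality: the sum is bounded by the larger of
    \<open>x\<close> and \<open>y\<close>, which is strictly below \<open>z\<close>.\<close>
  have strict_add: "\<not> le z (x + y)" if "\<not> le z x" "\<not> le z y" for x y z
    using that total trans add by (metis add.commute)
  have strict_sum: "\<not> le (t j) (sum t T)" if "finite T" "\<And>i. i \<in> T \<Longrightarrow> \<not> le (t j) (t i)" for T
    using that
    by (induction T rule: finite_induct) (simp_all add: nz[OF j(1)] strict_add)
  have "sum t (S - {j}) = - t j"
    using sum S j(1) by (simp add: sum_diff1)
  moreover have "le (t j) (- t j)" using uminus[of "- t j"] by simp
  ultimately obtain i where "i \<in> S - {j}" "le (t j) (t i)"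
    using strict_sum[of "S - {j}"] S by (metis finite_Diff)
  then show ?thesis using j by blast
qed

section \<open>Finite extensions\<close>

context finite_field_extension
begin

section \<open>The embedding of the base field as a field homomorphism\<close>

lemma emb_zero: "\<iota> 0 = 0"
  using hom_add[of 0 0] by (metis add_0 add_cancel_left_left)

lemma emb_uminus: "\<iota> (- a) = - \<iota> a"
  using hom_add[of a "- a"] by (simp add: emb_zero eq_neg_iff_add_eq_0 add.commute)

lemma emb_eq_zero_iff [simp]: "\<iota> a = 0 \<longleftrightarrow> a = 0"
proof
  assume "\<iota> a = 0"
  then show "a = 0"
    using hom_mult[of a "inverse a"] hom_one by (cases "a = 0") auto
qed (simp add: emb_zero)

lemma emb_inverse: "\<iota> (inverse a) = inverse (\<iota> a)"
  using hom_mult[of a "inverse a"] hom_one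
  by (cases "a = 0") (auto simp: emb_zero intro!: inverse_unique[symmetric])

lemma emb_divide: "\<iota> (a / b) = \<iota> a / \<iota> b"
  by (simp add: divide_inverse hom_mult emb_inverse)

lemma emb_power: "\<iota> (a ^ n) = \<iota> a ^ n"
  by (induction n) (auto simp: hom_one hom_mult)

text \<open>\<open>N\<close> is the dimension of \<open>E\<close> over \<open>F\<close>. Indexed
  families are used instead of sets so that repeated vectors, such as coinciding powers, also give a
  relation.\<close>

lemma ex_linear_relation:
  "\<exists>N. \<forall>S (x :: 'i \<Rightarrow> 'e). finite S \<and> N < card S \<longrightarrow>
    (\<exists>a. (\<exists>i\<in>S. a i \<noteq> 0) \<and> (\<Sum>i\<in>S. \<iota> (a i) * x i) = 0)"
proof -
  obtain B where "finite_dimensional_vector_space (\<lambda>a x. \<iota> a * x) B" using finite_dim by blast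
  then interpret E: finite_dimensional_vector_space "\<lambda>a x. \<iota> a * x" B .
  have "\<exists>a. (\<exists>i\<in>S. a i \<noteq> 0) \<and> (\<Sum>i\<in>S. \<iota> (a i) * x i) = 0"
    if S: "finite S" "E.dim UNIV < card S" for S and x :: "'i \<Rightarrow> 'e"
  proof (cases "inj_on x S")
    case True
    then have "E.dependent (x ` S)"
      using E.independent_card_le_dim[of "x ` S" UNIV] S by (auto simp: card_image)
    then obtain u where "\<exists>y\<in>x ` S. u y \<noteq> 0" "(\<Sum>y\<in>x ` S. \<iota> (u y) * y) = 0"
      using E.dependent_finite[of "x ` S"] S by auto
    then show ?thesis
      using True by (intro exI[of _ "u \<circ> x"]) (auto simp: sum.reindex)
  next
    case False
    then obtain i j where ij: "i \<in> S" "j \<in> S" "i \<noteq> j" "x i = x j" by (auto simp: inj_on_def)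
    \<comment> \<open>These coefficients encode the relation \<open>x i - x j = 0\<close>.\<close>
    define a where "a k = (if k = i then 1 else if k = j then - 1 else 0 :: 'f)" for k
    have "(\<Sum>k\<in>S. \<iota> (a k) * x k) = (\<Sum>k\<in>{i, j}. \<iota> (a k) * x k)"
      using ij S by (intro sum.mono_neutral_right) (auto simp: a_def emb_zero)
    also have "\<dots> = 0"
      using ij by (simp add: a_def hom_one emb_uminus)
    finally show ?thesis
      using ij by (intro exI[of _ a]) (auto simp: a_def)
  qed
  then show ?thesis by blast
qed

text \<open>
  Here \<open>le y x\<close> reads ``the value of \<open>y\<close> is at least that of \<open>x\<close>'', both for the divisibility
  preorder of a valuation ring and for an exponential quasi-valuation.
\<close>

lemma ex_comparable_powers:
  fixes le :: "'e \<Rightarrow> 'e \<Rightarrow> bool"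
  assumes total: "\<And>x y. le x y \<or> le y x"
    and trans: "\<And>x y z. le x y \<Longrightarrow> le y z \<Longrightarrow> le x z"
    and add: "\<And>x y z. le x z \<Longrightarrow> le y z \<Longrightarrow> le (x + y) z"
    and uminus: "\<And>x. le (- x) x"
    and nz: "\<And>y. y \<noteq> 0 \<Longrightarrow> \<not> le y 0" and x: "x \<noteq> 0"
  obtains i j a b where "i < j" "a \<noteq> 0" "b \<noteq> 0"
    "le (\<iota> a * x ^ i) (\<iota> b * x ^ j)" "le (\<iota> b * x ^ j) (\<iota> a * x ^ i)"
proof -
  obtain N where N: "\<forall>S (x :: nat \<Rightarrow> 'e). finite S \<and> N < card S \<longrightarrow>
    (\<exists>a. (\<exists>i\<in>S. a i \<noteq> 0) \<and> (\<Sum>i\<in>S. \<iota> (a i) * x i) = 0)"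
    using ex_linear_relation ..
  \<comment> \<open>The exponents from 0 to \<open>N\<close> number \<open>N + 1\<close>, one more
    than the bound.\<close>
  obtain a where a: "\<exists>i\<in>{..N}. a i \<noteq> 0" "(\<Sum>i\<le>N. \<iota> (a i) * x ^ i) = 0"
    using N[rule_format, of "{..N}" "\<lambda>i. x ^ i"] by auto
  \<comment> \<open>Terms with zero coefficient are dropped, as \<open>two_dominant_terms\<close>
    asks for nonzero terms.\<close>
  define S where "S = {i \<in> {..N}. a i \<noteq> 0}"
  have "(\<Sum>i\<in>S. \<iota> (a i) * x ^ i) = (\<Sum>i\<le>N. \<iota> (a i) * x ^ i)"
    by (rule sum.mono_neutral_left) (auto simp: S_def emb_zero)
  then have sum: "(\<Sum>i\<in>S. \<iota> (a i) * x ^ i) = 0" using a(2) by simp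
  have S: "finite S" "S \<noteq> {}" using a(1) by (auto simp: S_def)
  have nz': "\<not> le (\<iota> (a i) * x ^ i) 0" if "i \<in> S" for i
    using that x by (intro nz) (auto simp: S_def)
  have "\<exists>i\<in>S. \<exists>j\<in>S. i \<noteq> j \<and>
      le (\<iota> (a i) * x ^ i) (\<iota> (a j) * x ^ j) \<and> le (\<iota> (a j) * x ^ j) (\<iota> (a i) * x ^ i)"
  proof (rule two_dominant_terms)
    show "le x z" if "le x y" "le y z" for x y z
      using that by (rule trans)
    show "le (x + y) z" if "le x z" "le y z" for x y z
      using that by (rule add)
  qed (fact total uminus S sum nz')+
  then obtain i j where ij: "i \<in> S" "j \<in> S" "i \<noteq> j"
    "le (\<iota> (a i) * x ^ i) (\<iota> (a j) * x ^ j)" "le (\<iota> (a j) * x ^ j) (\<iota> (a i) * x ^ i)"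
    by blast
  then show thesis
    using that[of i j "a i" "a j"] that[of j i "a j" "a i"] by (cases "i < j") (auto simp: S_def)
qed

end

section \<open>Valuations\<close>

lemma nsmul_Fin [simp]: "nsmul n (Fin g) = Fin (nsmul n g)"
  by (induction n) (auto simp: zero_with_infty_def)

lemma nsmul_Infty [simp]: "0 < n \<Longrightarrow> nsmul n (Infty :: 'a::comm_monoid_add with_infty) = Infty"
  by (cases n) auto

lemma Fin_nonneg_iff [simp]: "0 \<le> Fin g \<longleftrightarrow> 0 \<le> g"
  by (simp add: zero_with_infty_def)

lemma Fin_eq_zero_iff [simp]: "Fin g = 0 \<longleftrightarrow> g = 0"
  by (simp add: zero_with_infty_def)

lemma valuation_zero_iff: "valuation v \<Longrightarrow> v x = Infty \<longleftrightarrow> x = 0"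
  and valuation_mult: "valuation v \<Longrightarrow> v (x * y) = v x + v y"
  and valuation_add: "valuation v \<Longrightarrow> min (v x) (v y) \<le> v (x + y)"
  by (auto simp: valuation_def)

lemma valuation_FinE:
  assumes "valuation v" "x \<noteq> 0"
  obtains g where "v x = Fin g"
  using assms by (cases "v x") (auto simp: valuation_def)

lemma valuation_one:
  assumes "valuation v" shows "v 1 = 0"
proof -
  obtain g where g: "v 1 = Fin g" using valuation_FinE[OF assms, of 1] by auto
  then show ?thesis using valuation_mult[OF assms, of 1 1] by simp
qed

lemma valuation_uminus:
  assumes "valuation v" shows "v (- x) = v x"
proof -
  obtain g where g: "v (- 1) = Fin g" using valuation_FinE[OF assms, of "- 1"] by auto
  then have "g = 0"
    using valuation_mult[OF assms, of "- 1" "- 1"] valuation_one[OF assms] by (simp add: zero_with_infty_def)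
  then show ?thesis
    using valuation_mult[OF assms, of "- 1" x] g by (simp flip: zero_with_infty_def)
qed

lemma valuation_power:
  assumes "valuation v" shows "v (x ^ n) = nsmul n (v x)"
  by (induction n) (auto simp: valuation_one[OF assms] valuation_mult[OF assms])

lemma valuation_inverse:
  assumes "valuation v" "v x = Fin g" shows "v (inverse x) = Fin (- g)"
proof -
  have x: "x \<noteq> 0" using assms valuation_zero_iff[OF assms(1), of x] by auto
  then obtain h where h: "v (inverse x) = Fin h" using valuation_FinE[OF assms(1), of "inverse x"] by auto
  then have "g + h = 0"
    using valuation_mult[OF assms(1), of x "inverse x"] valuation_one[OF assms(1)] x assms(2)
    by (simp add: zero_with_infty_def)
  then show ?thesis using h by (simp add: minus_unique[symmetric])
qed

lemma valuation_divide:
  assumes "valuation v" "v x = Fin g" "v y = Fin h" shows "v (x / y) = Fin (g - h)"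
  using valuation_mult[OF assms(1), of x "inverse y"] valuation_inverse[OF assms(1,3)] assms(2)
  by (simp add: divide_inverse)

section \<open>The value group as a subgroup and its image in the divisible hull\<close>

lemma value_group_zero: "valuation v \<Longrightarrow> 0 \<in> value_group v"
  by (auto simp: value_group_def zero_with_infty_def dest: valuation_one intro!: exI[of _ 1])

lemma value_groupI: "valuation v \<Longrightarrow> v x = Fin g \<Longrightarrow> g \<in> value_group v"
  using valuation_zero_iff[of v x] by (auto simp: value_group_def)

lemma value_groupE:
  assumes "g \<in> value_group v" obtains x where "x \<noteq> 0" "v x = Fin g"
  using assms by (auto simp: value_group_def)

lemma value_group_add:
  assumes "valuation v" "g \<in> value_group v" "h \<in> value_group v" shows "g + h \<in> value_group v"
proof -
  obtain x y where "v x = Fin g" "v y = Fin h" using assms(2,3) by (meson value_groupE)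
  then have "v (x * y) = Fin (g + h)" by (simp add: valuation_mult[OF assms(1)])
  then show ?thesis by (rule value_groupI[OF assms(1)])
qed

lemma value_group_uminus: "valuation v \<Longrightarrow> g \<in> value_group v \<Longrightarrow> - g \<in> value_group v"
  by (meson value_groupE value_groupI valuation_inverse)

lemma value_group_diff:
  "valuation v \<Longrightarrow> g \<in> value_group v \<Longrightarrow> h \<in> value_group v \<Longrightarrow> g - h \<in> value_group v"
  using value_group_add[OF _ _ value_group_uminus, of v g h] by simp

lemma value_group_nsmul: "valuation v \<Longrightarrow> g \<in> value_group v \<Longrightarrow> nsmul n g \<in> value_group v"
  by (induction n) (auto intro: value_group_zero value_group_add)

lemma to_div_hull_nsmul: "to_div_hull (nsmul n g) = nsmul n (to_div_hull g)"
  by (induction n) (auto simp: to_div_hull_zero to_div_hull_add)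

lemma to_div_hull_uminus: "to_div_hull (- g) = - to_div_hull g"
  using to_div_hull_add[of g "- g"] by (simp add: to_div_hull_zero add_eq_0_iff)

section \<open>Valuation rings over the valuation ring of the base field\<close>

locale valued_extension = finite_field_extension \<iota>
  for \<iota> :: "'f::field \<Rightarrow> 'e::field" +
  fixes v :: "'f \<Rightarrow> 'g::linordered_ab_group_add with_infty"
  assumes val: "valuation v"
begin

text \<open>The contraction to \<open>F\<close> is exactly the valuation ring of \<open>v\<close>; a
  larger contraction would belong to a coarsening of \<open>v\<close>.\<close>

definition lies_over :: "'e set \<Rightarrow> bool" where
  "lies_over V \<longleftrightarrow> valuation_ring V \<and> (\<forall>a. \<iota> a \<in> V \<longleftrightarrow> 0 \<le> v a)"

lemma lies_over_valuation_ring: "lies_over V \<Longrightarrow> valuation_ring V"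
  by (simp add: lies_over_def)

lemma lies_over_emb_iff: "lies_over V \<Longrightarrow> \<iota> a \<in> V \<longleftrightarrow> 0 \<le> v a"
  by (simp add: lies_over_def)

text \<open>Applied to divisibility in \<open>V\<close>, \<open>ex_comparable_powers\<close> makes
  \<open>\<iota> a * x ^ i\<close> and \<open>\<iota> b * x ^ j\<close> associates, so
  \<open>x ^ (j - i)\<close> is an associate of \<open>\<iota> (a / b)\<close>. This is torsion of
  the value group of \<open>V\<close> over that of \<open>v\<close>.\<close>

lemma ex_power_equiv:
  assumes "lies_over V" and x: "x \<noteq> 0"
  shows "\<exists>n>0. \<exists>c. c \<noteq> 0 \<and> x ^ n / \<iota> c \<in> V \<and> \<iota> c / x ^ n \<in> V"
proof -
  interpret valuation_ring V using assms(1) by (rule lies_over_valuation_ring)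
  define le where "le y x \<longleftrightarrow> (\<exists>r\<in>V. y = r * x)" for y x
  obtain i j a b where ij: "i < j" and ab: "a \<noteq> 0" "b \<noteq> 0"
    and le: "le (\<iota> a * x ^ i) (\<iota> b * x ^ j)" "le (\<iota> b * x ^ j) (\<iota> a * x ^ i)"
  proof (rule ex_comparable_powers[of le])
    fix x y z
    show "le x y \<or> le y x"
    proof (cases "x = 0 \<or> y = 0")
      case True
      then show ?thesis by (auto simp: le_def intro: bexI[OF _ zero_mem])
    next
      case False
      have "x / y \<in> V \<or> y / x \<in> V" using total[of "x / y"] by simp
      then show ?thesis
      proof
        assume "x / y \<in> V"
        then have "le x y" unfolding le_def using False by (intro bexI[of _ "x / y"]) auto
        then show ?thesis ..
      next
        assume "y / x \<in> V"
        then have "le y x" unfolding le_def using False by (intro bexI[of _ "y / x"]) auto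
        then show ?thesis ..
      qed
    qed
    show "le x z" if "le x y" "le y z"
      using that unfolding le_def by (metis mult.assoc mult_mem)
    show "le (x + y) z" if "le x z" "le y z"
      using that unfolding le_def by (metis distrib_right add_mem)
    show "le (- x) x"
      unfolding le_def using uminus_mem[OF one_mem] by force
    show "\<not> le y 0" if "y \<noteq> 0"
      using that by (auto simp: le_def)
  next
    show "x \<noteq> 0" by fact
  next
    fix i j a b
    assume "i < j" "a \<noteq> 0" "b \<noteq> 0"
      "le (\<iota> a * x ^ i) (\<iota> b * x ^ j)" "le (\<iota> b * x ^ j) (\<iota> a * x ^ i)"
    then show thesis by (rule that)
  qed
  obtain r s where rs: "r \<in> V" "\<iota> a * x ^ i = r * (\<iota> b * x ^ j)"
    "s \<in> V" "\<iota> b * x ^ j = s * (\<iota> a * x ^ i)"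
    using le unfolding le_def by blast
  have j: "x ^ j = x ^ (j - i) * x ^ i" using ij by (simp flip: power_add)
  have "\<iota> (a / b) / x ^ (j - i) = r"
  proof -
    have "\<iota> a * x ^ i = r * \<iota> b * x ^ (j - i) * x ^ i"
      using rs(2) unfolding j by (simp only: mult.assoc)
    then have "\<iota> a = r * \<iota> b * x ^ (j - i)" using x by simp
    then show ?thesis using ab x by (simp add: emb_divide)
  qed
  moreover have "x ^ (j - i) / \<iota> (a / b) = s"
  proof -
    have "\<iota> b * x ^ (j - i) * x ^ i = s * \<iota> a * x ^ i"
      using rs(4) unfolding j by (simp only: mult.assoc)
    then have "\<iota> b * x ^ (j - i) = s * \<iota> a" using x by simp
    then show ?thesis using ab x by (simp add: emb_divide field_simps)
  qed
  ultimately show ?thesis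
    using rs(1,3) ij ab by (intro exI[of _ "j - i"] conjI exI[of _ "a / b"]) auto
qed

text \<open>For \<open>x\<close> in \<open>W\<close>, the element \<open>\<iota> c\<close>
  associated to \<open>x ^ n\<close> in \<open>V\<close> lies in \<open>W\<close>, hence in
  \<open>V\<close>, as both rings meet \<open>F\<close> in the same ring. Then \<open>x ^ n\<close>
  lies in \<open>V\<close>, and so does its root \<open>x\<close>.\<close>

lemma lies_over_incomparable:
  assumes V: "lies_over V" and W: "lies_over W" and "V \<subseteq> W"
  shows "V = W"
proof (intro equalityI subsetI)
  fix x assume x: "x \<in> W"
  interpret V: valuation_ring V using V by (rule lies_over_valuation_ring)
  interpret W: valuation_ring W using W by (rule lies_over_valuation_ring)
  show "x \<in> V"
  proof (cases "x = 0")
    case False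
    then obtain n c where n: "0 < n" and c: "c \<noteq> 0" "x ^ n / \<iota> c \<in> V" "\<iota> c / x ^ n \<in> V"
      using ex_power_equiv[OF V] by blast
    have "\<iota> c / x ^ n * x ^ n \<in> W"
      using c(3) x \<open>V \<subseteq> W\<close> by (intro W.mult_mem W.power_mem) auto
    then have "\<iota> c \<in> V"
      using False lies_over_emb_iff[OF V] lies_over_emb_iff[OF W] by simp
    then have "x ^ n / \<iota> c * \<iota> c \<in> V"
      using c(2) by (intro V.mult_mem)
    then show ?thesis
      using c(1) n by (simp add: V.power_mem_iff)
  qed (simp add: V.zero_mem)
qed (use assms in auto)

text \<open>
  Elements that are \<open>1\<close> at one valuation ring and vanish at the others, modulo the maximal ideals,
  are linearly independent over the base field.
\<close>

lemma finite_lies_over: "finite {V. lies_over V}"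
proof (rule ccontr)
  assume inf: "infinite {V. lies_over V}"
  obtain N where N: "\<forall>S (x :: 'e set \<Rightarrow> 'e). finite S \<and> N < card S \<longrightarrow>
    (\<exists>a. (\<exists>i\<in>S. a i \<noteq> 0) \<and> (\<Sum>i\<in>S. \<iota> (a i) * x i) = 0)"
    using ex_linear_relation ..
  obtain S where S: "finite S" "card S = Suc N" "S \<subseteq> {V. lies_over V}"
    using infinite_arbitrarily_large[OF inf] by blast
  have "\<exists>x. x - 1 \<in> nonunits V \<and> (\<forall>W\<in>S - {V}. x \<in> nonunits W)" if "V \<in> S" for V
    using S that by (intro ex_separating) (auto dest: lies_over_valuation_ring lies_over_incomparable)
  then obtain x where x: "\<And>V. V \<in> S \<Longrightarrow> x V - 1 \<in> nonunits V"
    "\<And>V W. V \<in> S \<Longrightarrow> W \<in> S - {V} \<Longrightarrow> x V \<in> nonunits W"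
    by metis
  obtain a where a: "\<exists>V\<in>S. a V \<noteq> 0" "(\<Sum>V\<in>S. \<iota> (a V) * x V) = 0"
    using N[rule_format, of S x] S by auto
  \<comment> \<open>Dividing the relation by a coefficient of least value makes all coefficients
    integral. It then writes \<open>x V\<close> as a sum of nonunits of \<open>V\<close>, although
    \<open>x V\<close> is congruent to 1.\<close>
  obtain V where V: "V \<in> S" "\<And>W. W \<in> S \<Longrightarrow> v (a V) \<le> v (a W)"
  proof -
    have "Min ((\<lambda>V. v (a V)) ` S) \<in> (\<lambda>V. v (a V)) ` S" using S(1) a(1) by (intro Min_in) auto
    then obtain V where V: "V \<in> S" "Min ((\<lambda>V. v (a V)) ` S) = v (a V)" by (rule imageE) simp
    have "v (a V) \<le> v (a W)" if "W \<in> S" for W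
      unfolding V(2)[symmetric] using S(1) that by (intro Min_le) auto
    then show thesis using that V(1) by blast
  qed
  interpret V: valuation_ring V using S V(1) lies_over_valuation_ring by auto
  have aV: "a V \<noteq> 0"
  proof
    assume "a V = 0"
    then have "v (a W) = Infty" if "W \<in> S" for W
      using V(2)[OF that] valuation_zero_iff[OF val, of 0] by (cases "v (a W)") auto
    then show False using a(1) valuation_zero_iff[OF val] by blast
  qed
  have mem: "\<iota> (a W / a V) \<in> V" if W: "W \<in> S" for W
  proof -
    have "0 \<le> v (a W / a V)"
    proof (cases "a W = 0")
      case False
      then obtain g h where gh: "v (a W) = Fin g" "v (a V) = Fin h"
        using aV val by (meson valuation_FinE)
      then show ?thesis using V(2)[OF W] valuation_divide[OF val gh] by simp
    qed (simp add: valuation_zero_iff[OF val, THEN iffD2])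
    then show ?thesis using S V(1) lies_over_emb_iff by auto
  qed
  have "x V + (\<Sum>W\<in>S - {V}. \<iota> (a W / a V) * x W) = (\<Sum>W\<in>S. \<iota> (a W / a V) * x W)"
    using aV S V(1) by (simp add: sum.remove hom_one)
  also have "\<dots> = (\<Sum>W\<in>S. \<iota> (a W) * x W) / \<iota> (a V)"
    by (simp add: sum_divide_distrib emb_divide)
  also have "\<dots> = 0" using a(2) by simp
  finally have eq: "x V = - (\<Sum>W\<in>S - {V}. \<iota> (a W / a V) * x W)"
    by (simp add: eq_neg_iff_add_eq_0)
  have "x V \<in> nonunits V" unfolding eq
    using x(2) V(1) mem by (intro V.nonunits_uminus V.nonunits_sum V.nonunits_mult') auto
  then show False using V.one_add_nonunits[OF x(1)[OF V(1)]] by simp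
qed

section \<open>The valuation of a valuation ring\<close>

text \<open>The value is \<open>d = v(c) / n\<close> when \<open>x ^ n\<close> and
  \<open>\<iota> c\<close> differ by a unit of \<open>V\<close>. It is stated as a relation because
  \<open>n\<close> and \<open>c\<close> are not unique.\<close>

definition has_value :: "'e set \<Rightarrow> 'e \<Rightarrow> 'g div_hull \<Rightarrow> bool" where
  "has_value V x d \<longleftrightarrow> (\<exists>n>0. \<exists>c g. v c = Fin g \<and> x ^ n / \<iota> c \<in> V \<and> \<iota> c / x ^ n \<in> V \<and>
    nsmul n d = to_div_hull g)"

lemma ex_has_value:
  assumes "lies_over V" "x \<noteq> 0"
  shows "\<exists>d. has_value V x d"
proof -
  obtain n c where n: "0 < n" and c: "c \<noteq> 0" "x ^ n / \<iota> c \<in> V" "\<iota> c / x ^ n \<in> V"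
    using ex_power_equiv[OF assms] by blast
  obtain g where "v c = Fin g" using valuation_FinE[OF val c(1)] .
  moreover obtain d where "nsmul n d = to_div_hull g" using div_hull_divisible[OF n] by blast
  ultimately show ?thesis using n c unfolding has_value_def by blast
qed

text \<open>The power \<open>n * m\<close> moves the comparison into \<open>F\<close>, where
  \<open>V\<close> agrees with \<open>v\<close>; closure of \<open>V\<close> under roots leads back
  to \<open>y / x\<close>. The case \<open>x = y\<close> gives uniqueness of the value.\<close>

lemma has_value_le_iff:
  assumes V: "lies_over V" and x: "x \<noteq> 0" "has_value V x d" and y: "y \<noteq> 0" "has_value V y e"
  shows "d \<le> e \<longleftrightarrow> y / x \<in> V"
proof -
  interpret valuation_ring V using V by (rule lies_over_valuation_ring)
  obtain n c g where n: "0 < n" and c: "v c = Fin g" "x ^ n / \<iota> c \<in> V" "\<iota> c / x ^ n \<in> V"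
    and d: "nsmul n d = to_div_hull g"
    using x(2) by (auto simp: has_value_def)
  obtain m b h where m: "0 < m" and b: "v b = Fin h" "y ^ m / \<iota> b \<in> V" "\<iota> b / y ^ m \<in> V"
    and e: "nsmul m e = to_div_hull h"
    using y(2) by (auto simp: has_value_def)
  have nz: "\<iota> c \<noteq> 0" "\<iota> b \<noteq> 0"
    using c(1) b(1) valuation_zero_iff[OF val, of c] valuation_zero_iff[OF val, of b] by simp_all
  have "d \<le> e \<longleftrightarrow> nsmul (m * n) d \<le> nsmul (n * m) e"
    using n m by (simp add: mult.commute)
  also have "\<dots> \<longleftrightarrow> nsmul m g \<le> nsmul n h"
    by (simp only: nsmul_mult d e to_div_hull_nsmul[symmetric] to_div_hull_le_iff)
  also have "\<dots> \<longleftrightarrow> 0 \<le> v (b ^ n / c ^ m)"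
    by (simp add: valuation_divide[OF val] valuation_power[OF val] b(1) c(1))
  also have "\<dots> \<longleftrightarrow> \<iota> b ^ n / \<iota> c ^ m \<in> V"
    by (simp add: lies_over_emb_iff[OF V, symmetric] emb_divide emb_power)
  also have "\<dots> \<longleftrightarrow> (y / x) ^ (n * m) \<in> V"
  proof
    assume "\<iota> b ^ n / \<iota> c ^ m \<in> V"
    then have "(\<iota> b ^ n / \<iota> c ^ m) * (y ^ m / \<iota> b) ^ n * (\<iota> c / x ^ n) ^ m \<in> V"
      using b(2) c(3) by (intro mult_mem power_mem)
    moreover have "(\<iota> b ^ n / \<iota> c ^ m) * (y ^ m / \<iota> b) ^ n * (\<iota> c / x ^ n) ^ m = (y / x) ^ (n * m)"
      using nz by (simp add: power_divide mult.commute[of n m] flip: power_mult)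
    ultimately show "(y / x) ^ (n * m) \<in> V" by simp
  next
    assume "(y / x) ^ (n * m) \<in> V"
    then have "(y / x) ^ (n * m) * (\<iota> b / y ^ m) ^ n * (x ^ n / \<iota> c) ^ m \<in> V"
      using b(3) c(2) by (intro mult_mem power_mem[of "_ / _ ^ m"] power_mem[of "x ^ n / _"])
    moreover have "(y / x) ^ (n * m) * (\<iota> b / y ^ m) ^ n * (x ^ n / \<iota> c) ^ m = \<iota> b ^ n / \<iota> c ^ m"
      using x(1) y(1) by (simp add: power_divide mult.commute[of n m] flip: power_mult)
    ultimately show "\<iota> b ^ n / \<iota> c ^ m \<in> V" by simp
  qed
  also have "\<dots> \<longleftrightarrow> y / x \<in> V" using n m by (simp add: power_mem_iff)
  finally show ?thesis .
qed

lemma has_value_mult: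
  assumes "lies_over V" "has_value V x d" "has_value V y e"
  shows "has_value V (x * y) (d + e)"
proof -
  interpret valuation_ring V using assms(1) by (rule lies_over_valuation_ring)
  obtain n c g where n: "0 < n" and c: "v c = Fin g" "x ^ n / \<iota> c \<in> V" "\<iota> c / x ^ n \<in> V"
    and d: "nsmul n d = to_div_hull g"
    using assms(2) by (auto simp: has_value_def)
  obtain m b h where m: "0 < m" and b: "v b = Fin h" "y ^ m / \<iota> b \<in> V" "\<iota> b / y ^ m \<in> V"
    and e: "nsmul m e = to_div_hull h"
    using assms(3) by (auto simp: has_value_def)
  have "(x * y) ^ (n * m) / \<iota> (c ^ m * b ^ n) = (x ^ n / \<iota> c) ^ m * (y ^ m / \<iota> b) ^ n"
    by (simp add: hom_mult emb_power power_mult_distrib power_divide flip: power_mult) (simp add: mult.commute)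
  also have "\<dots> \<in> V" using b(2) c(2) by (intro mult_mem power_mem)
  finally have 1: "(x * y) ^ (n * m) / \<iota> (c ^ m * b ^ n) \<in> V" .
  have "\<iota> (c ^ m * b ^ n) / (x * y) ^ (n * m) = (\<iota> c / x ^ n) ^ m * (\<iota> b / y ^ m) ^ n"
    by (simp add: hom_mult emb_power power_mult_distrib power_divide flip: power_mult) (simp add: mult.commute)
  also have "\<dots> \<in> V" using b(3) c(3) by (intro mult_mem power_mem)
  finally have 2: "\<iota> (c ^ m * b ^ n) / (x * y) ^ (n * m) \<in> V" .
  have "nsmul (n * m) (d + e) = nsmul m (nsmul n d) + nsmul n (nsmul m e)"
    unfolding nsmul_add nsmul_mult by (simp add: nsmul_commute)
  also have "\<dots> = to_div_hull (nsmul m g + nsmul n h)"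
    by (simp add: d e to_div_hull_nsmul to_div_hull_add)
  finally show ?thesis
    using 1 2 n m unfolding has_value_def
    by (intro exI[of _ "n * m"] conjI exI[of _ "c ^ m * b ^ n"] exI[of _ "nsmul m g + nsmul n h"])
       (auto simp: valuation_mult[OF val] valuation_power[OF val] b(1) c(1))
qed

lemma has_value_emb:
  assumes "lies_over V" "v a = Fin g"
  shows "has_value V (\<iota> a) (to_div_hull g)"
proof -
  interpret valuation_ring V using assms(1) by (rule lies_over_valuation_ring)
  have "\<iota> a \<noteq> 0" using assms(2) valuation_zero_iff[OF val, of a] by simp
  then show ?thesis
    using assms(2) unfolding has_value_def
    by (intro exI[of _ "1::nat"] conjI exI[of _ a] exI[of _ g]) (auto simp: one_mem)
qed

lemma has_value_in_hull:
  assumes "has_value V x d" shows "d \<in> value_div_hull v"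
  using assms value_groupI[OF val] unfolding has_value_def value_div_hull_def by blast

definition ring_valuation :: "'e set \<Rightarrow> 'e \<Rightarrow> 'g div_hull with_infty" where
  "ring_valuation V x = (if x = 0 then Infty else Fin (THE d. has_value V x d))"

lemma ring_valuation_eqI:
  assumes V: "lies_over V" and "x \<noteq> 0" "has_value V x d"
  shows "ring_valuation V x = Fin d"
proof -
  interpret valuation_ring V using V by (rule lies_over_valuation_ring)
  have "e = d" if "has_value V x e" for e
    using has_value_le_iff[OF V assms(2) that assms(2,3)]
      has_value_le_iff[OF V assms(2,3) assms(2) that] assms(2) one_mem by simp
  then show ?thesis
    using assms(2) the_equality[of "has_value V x", OF assms(3)] by (simp add: ring_valuation_def)
qed

lemma ring_valuation_FinE:
  assumes "lies_over V" and "x \<noteq> 0"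
  obtains d where "has_value V x d" "ring_valuation V x = Fin d"
  using ex_has_value[OF assms] ring_valuation_eqI[OF assms] by blast

lemma valuation_ring_valuation:
  assumes V: "lies_over V" shows "valuation (ring_valuation V)"
  unfolding valuation_def
proof (intro conjI allI)
  interpret valuation_ring V using V by (rule lies_over_valuation_ring)
  fix x y
  show "ring_valuation V x = Infty \<longleftrightarrow> x = 0" by (simp add: ring_valuation_def)
  show "ring_valuation V (x * y) = ring_valuation V x + ring_valuation V y"
  proof (cases "x = 0 \<or> y = 0")
    case True
    then show ?thesis by (auto simp: ring_valuation_def)
  next
    case False
    obtain d where d: "has_value V x d" "ring_valuation V x = Fin d"
      using ring_valuation_FinE[OF V, of x] False by blast
    obtain e where e: "has_value V y e" "ring_valuation V y = Fin e"
      using ring_valuation_FinE[OF V, of y] False by blast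
    show ?thesis
      using False d(2) e(2) ring_valuation_eqI[OF V _ has_value_mult[OF V d(1) e(1)]] by simp
  qed
  have *: "ring_valuation V x \<le> ring_valuation V (x + y)"
    if nz: "x \<noteq> 0" "y \<noteq> 0" "x + y \<noteq> 0" and le: "ring_valuation V x \<le> ring_valuation V y" for x y
  proof -
    obtain d where d: "has_value V x d" "ring_valuation V x = Fin d"
      using ring_valuation_FinE[OF V nz(1)] .
    obtain e where e: "has_value V y e" "ring_valuation V y = Fin e"
      using ring_valuation_FinE[OF V nz(2)] .
    obtain f where f: "has_value V (x + y) f" "ring_valuation V (x + y) = Fin f"
      using ring_valuation_FinE[OF V nz(3)] .
    have "y / x \<in> V" using has_value_le_iff[OF V nz(1) d(1) nz(2) e(1)] le d(2) e(2) by simp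
    then have "1 + y / x \<in> V" by (intro add_mem one_mem)
    then have "(x + y) / x \<in> V" using nz(1) by (simp add: add_divide_distrib)
    then show ?thesis using has_value_le_iff[OF V nz(1) d(1) nz(3) f(1)] d(2) f(2) by simp
  qed
  show "min (ring_valuation V x) (ring_valuation V y) \<le> ring_valuation V (x + y)"
  proof (cases "x = 0 \<or> y = 0 \<or> x + y = 0")
    case True
    then show ?thesis by (auto simp: ring_valuation_def)
  next
    case False
    then show ?thesis using *[of x y] *[of y x] by (auto simp: min_def add.commute)
  qed
qed

lemma hull_extension_ring_valuation:
  assumes V: "lies_over V" shows "hull_extension \<iota> v (ring_valuation V)"
  unfolding hull_extension_def extends_along_def
proof (intro conjI allI impI)
  fix a show "ring_valuation V (\<iota> a) = map_with_infty to_div_hull (v a)"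
  proof (cases "v a")
    case (Fin g)
    then have "a \<noteq> 0" using valuation_zero_iff[OF val, of a] by auto
    then show ?thesis using ring_valuation_eqI[OF V _ has_value_emb[OF V Fin]] Fin by simp
  qed (use valuation_zero_iff[OF val, of a] in \<open>simp add: ring_valuation_def\<close>)
next
  fix x d assume d: "ring_valuation V x = Fin d"
  then have "x \<noteq> 0" by (auto simp: ring_valuation_def)
  then show "d \<in> value_div_hull v"
    using ring_valuation_FinE[OF V] d has_value_in_hull by (metis with_infty.inject)
qed

lemma qv_ring_ring_valuation:
  assumes V: "lies_over V" shows "qv_ring (ring_valuation V) = V"
proof (intro set_eqI)
  interpret valuation_ring V using V by (rule lies_over_valuation_ring)
  fix x
  have one: "has_value V 1 0"
    using has_value_emb[OF V, of 1 0] valuation_one[OF val]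
    by (simp add: hom_one to_div_hull_zero zero_with_infty_def)
  show "x \<in> qv_ring (ring_valuation V) \<longleftrightarrow> x \<in> V"
  proof (cases "x = 0")
    case False
    then obtain d where "has_value V x d" "ring_valuation V x = Fin d"
      using ring_valuation_FinE[OF V] by blast
    then show ?thesis using has_value_le_iff[OF V _ one False] by (simp add: qv_ring_def)
  qed (simp add: qv_ring_def ring_valuation_def zero_mem)
qed

section \<open>Integrally closed rings as intersections\<close>

text \<open>
  The last hypothesis says that the maximal ideal of \<open>v\<close> generates an ideal inside the Jacobson
  radical of \<open>R\<close>; it forces the valuation rings found below to lie exactly over that of \<open>v\<close>.
\<close>

lemma ex_lies_over_avoiding:
  assumes "field_subring R" and base: "\<And>a. 0 \<le> v a \<Longrightarrow> \<iota> a \<in> R"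
    and closed: "integrally_closed R" and x: "x \<notin> R"
    and jacobson: "\<And>a y. 0 < v a \<Longrightarrow> y \<in> R \<Longrightarrow> 1 + \<iota> a * y \<noteq> 0 \<and> inverse (1 + \<iota> a * y) \<in> R"
  obtains V where "lies_over V" "R \<subseteq> V" "x \<notin> V"
proof -
  interpret R: field_subring R by (rule assms(1))
  \<comment> \<open>The extension to \<open>R\<close> of the maximal ideal of \<open>v\<close>.
    Single products suffice instead of sums, since of two base elements the one of smaller value can
    be factored out.\<close>
  define I where "I = {\<iota> a * y | a y. 0 < v a \<and> y \<in> R}"
  have v0: "v 0 = Infty" using valuation_zero_iff[OF val, of 0] by simp
  have pos0: "0 < v 0" by (simp add: v0 zero_with_infty_def less_with_infty_def)
  have unit: "1 - y \<noteq> 0 \<and> inverse (1 - y) \<in> R" if "y \<in> I" for y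
    using that jacobson R.uminus_mem by (fastforce simp: I_def)
  have sum_mem: "\<iota> a * y + \<iota> b * z \<in> I"
    if "0 < v a" "y \<in> R" "0 < v b" "z \<in> R" "v a \<le> v b" for a b y z
  proof (cases "b = 0")
    case True
    then have "\<iota> a * y + \<iota> b * z = \<iota> a * y" by (simp add: emb_zero)
    then show ?thesis using that(1,2) unfolding I_def by blast
  next
    case False
    then have "a \<noteq> 0" using that(5) v0 valuation_zero_iff[OF val, of b] by (cases "v b") auto
    then obtain g h where gh: "v a = Fin g" "v b = Fin h"
      using False val by (meson valuation_FinE)
    then have "\<iota> (b / a) \<in> R"
      using valuation_divide[OF val gh(2,1)] that(5) by (intro base) simp
    moreover have "\<iota> a * y + \<iota> b * z = \<iota> a * (y + \<iota> (b / a) * z)"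
      using \<open>a \<noteq> 0\<close> by (simp add: emb_divide distrib_left)
    ultimately show ?thesis
      using that unfolding I_def by (auto intro!: exI R.add_mem R.mult_mem)
  qed
  interpret R: proper_ideal R I
  proof
    show "I \<subseteq> R" by (auto simp: I_def intro: R.mult_mem base less_imp_le)
    show "0 \<in> I" using pos0 R.zero_mem by (auto simp: I_def)
    show "x + y \<in> I" if "x \<in> I" "y \<in> I" for x y
    proof -
      obtain a b y' z where "x = \<iota> a * y'" "y = \<iota> b * z" "0 < v a" "0 < v b" "y' \<in> R" "z \<in> R"
        using \<open>x \<in> I\<close> \<open>y \<in> I\<close> by (auto simp: I_def)
      then show ?thesis
        using sum_mem[of a y' b z] sum_mem[of b z a y'] by (cases "v a \<le> v b") (auto simp: add.commute)
    qed
    show "x * y \<in> I" if "x \<in> R" "y \<in> I" for x y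
    proof -
      obtain a z where "y = \<iota> a * z" "0 < v a" "z \<in> R" using \<open>y \<in> I\<close> by (auto simp: I_def)
      then have "x * y = \<iota> a * (x * z)" "x * z \<in> R" using \<open>x \<in> R\<close> by (auto simp: R.mult_mem)
      then show ?thesis using \<open>0 < v a\<close> unfolding I_def by blast
    qed
    show "1 \<notin> I" using unit[of 1] by auto
  qed
  have x0: "x \<noteq> 0" using x R.zero_mem by auto
  define A where "A = {poly p (inverse x) | p. \<forall>i. coeff p i \<in> R}"
  \<comment> \<open>The ideal of \<open>R[1/x]\<close> generated by \<open>1/x\<close> and
    \<open>I\<close>: only the constant coefficient is restricted to \<open>I\<close>.\<close>
  define L where "L = {poly p (inverse x) | p. coeff p 0 \<in> I \<and> (\<forall>i. coeff p i \<in> R)}"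
  have "proper_ideal A L" unfolding A_def L_def
  proof (rule R.adjoin_proper_ideal[OF R.ideal_subset order_refl R.add_mem R.mult_mem], assumption+, rule notI)
    assume "\<exists>p. coeff p 0 \<in> I \<and> (\<forall>i. coeff p i \<in> R) \<and> poly p (inverse x) = 1"
    then obtain p where p: "coeff p 0 \<in> I" "\<And>i. coeff p i \<in> R" "poly p (inverse x) = 1" by blast
    \<comment> \<open>The relation multiplied by \<open>x ^ degree p\<close> becomes an equation for
      \<open>x\<close> with top coefficient \<open>1 - coeff p 0\<close>, a unit of
      \<open>R\<close>. Scaling by its inverse \<open>c\<close> gives an integral equation.\<close>
    define c where "c = inverse (1 - coeff p 0)"
    define s where "s = smult c (monom 1 (degree p) - reflect_poly p)"
    have c: "c \<in> R" "c * (1 - coeff p 0) = 1" using unit[OF p(1)] by (auto simp: c_def)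
    have "coeff s (degree p) = 1" using c(2) by (simp add: s_def coeff_reflect_poly)
    moreover have "degree s \<le> degree p"
      by (rule degree_le) (simp add: s_def coeff_reflect_poly)
    ultimately have "lead_coeff s = 1"
      by (metis coeff_eq_0 le_antisym le_degree zero_neq_one)
    moreover have "coeff s i \<in> R" for i
      using c(1) p(2) by (auto simp: s_def coeff_reflect_poly R.zero_mem R.one_mem intro!: R.uminus_mem R.mult_mem R.diff_mem)
    moreover have "poly s x = 0"
      using x0 p(3) by (simp add: s_def poly_monom poly_reflect_poly_nz)
    ultimately have "integral_over R x" unfolding integral_over_def by blast
    then show False using closed x by (auto simp: integrally_closed_def integral_closure_def)
  qed
  then obtain V where V: "valuation_ring V" "A \<subseteq> V" "L \<subseteq> nonunits V"
    by (rule chevalley_extension)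
  interpret V: valuation_ring V by fact
  have RA: "y \<in> A" if "y \<in> R" for y
    using that unfolding A_def
    by (auto intro!: exI[of _ "[:y:]"] simp: coeff_pCons R.zero_mem split: nat.splits)
  have IL: "y \<in> L" if "y \<in> I" for y
    using that R.ideal_subset unfolding L_def
    by (auto intro!: exI[of _ "[:y:]"] simp: coeff_pCons R.zero_mem split: nat.splits)
  have "inverse x \<in> L" unfolding L_def
    by (auto intro!: exI[of _ "[:0, 1:]"] simp: coeff_pCons R.zero_mem R.one_mem R.ideal_zero split: nat.splits)
  then have "x \<notin> V" using V(3) x0 by (auto simp: nonunits_def)
  moreover have "\<iota> a \<in> V \<longleftrightarrow> 0 \<le> v a" for a
  proof
    assume "0 \<le> v a"
    then show "\<iota> a \<in> V" using base RA V(2) by auto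
  next
    assume a: "\<iota> a \<in> V"
    show "0 \<le> v a"
    proof (rule ccontr)
      \<comment> \<open>A negative value puts \<open>inverse a\<close> into the maximal ideal of
        \<open>v\<close>. Its image is then a nonunit of \<open>V\<close>, so \<open>V\<close>
        cannot contain \<open>\<iota> a\<close>.\<close>
      assume neg: "\<not> 0 \<le> v a"
      then obtain g where g: "v a = Fin g" "g < 0" by (cases "v a") (auto simp: zero_with_infty_def)
      then have "0 < v (inverse a)"
        using valuation_inverse[OF val g(1)] less_imp_le[OF g(2)]
        by (simp add: less_with_infty_def zero_with_infty_def)
      then have "\<iota> (inverse a) * 1 \<in> I" using R.one_mem unfolding I_def by blast
      then have "inverse (\<iota> a) \<in> nonunits V" using IL V(3) by (auto simp: emb_inverse)
      moreover have "a \<noteq> 0" using g v0 by auto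
      ultimately show False using a by (simp add: nonunits_def)
    qed
  qed
  ultimately show thesis using that[of V] V(1,2) RA by (auto simp: lies_over_def)
qed

end

section \<open>Quasi-valuations extending a valuation\<close>

lemma nsmul_mono_monoid: "a \<le> b \<Longrightarrow> nsmul n a \<le> nsmul n (b :: 'm::ordered_comm_monoid_add)"
  by (induction n) (auto intro: add_mono)

lemma nsmul_antimono:
  fixes a :: "'m::ordered_comm_monoid_add"
  assumes "a \<le> 0" "i \<le> k" shows "nsmul k a \<le> nsmul i a"
proof -
  have "nsmul k a = nsmul i a + nsmul (k - i) a"
    using assms(2) by (simp flip: nsmul_add_left)
  also have "\<dots> \<le> nsmul i a + 0"
    using nsmul_mono_monoid[OF assms(1), of "k - i"] by (intro add_left_mono) simp
  finally show ?thesis by simp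
qed

lemma quasi_valuation_zero: "quasi_valuation w \<Longrightarrow> w 0 = Infty"
  and quasi_valuation_mult: "quasi_valuation w \<Longrightarrow> w x + w y \<le> w (x * y)"
  and quasi_valuation_add: "quasi_valuation w \<Longrightarrow> min (w x) (w y) \<le> w (x + y)"
  by (auto simp: quasi_valuation_def)

lemma quasi_valuation_sum:
  assumes "quasi_valuation w" "\<And>i. i \<in> S \<Longrightarrow> c \<le> w (f i)"
  shows "c \<le> w (sum f S)"
  using assms(2)
proof (induction S rule: infinite_finite_induct)
  case (insert i S)
  then show ?case
    using quasi_valuation_add[OF assms(1), of "f i" "sum f S"]
      insert.IH insert.prems insert.hyps by (fastforce simp: min_le_iff_disj intro: order_trans)
qed (simp_all add: quasi_valuation_zero[OF assms(1)])

lemma value_monoid_nsmul: "a \<in> value_monoid w \<Longrightarrow> nsmul n a \<in> value_monoid w"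
  by (induction n) (auto intro: value_monoid.zero value_monoid.add)

lemma ordered_embedding_onD:
  assumes "ordered_embedding_on S j"
  shows "j 0 = 0" "\<And>a b. a \<in> S \<Longrightarrow> b \<in> S \<Longrightarrow> j (a + b) = j a + j b"
    "\<And>a b. a \<in> S \<Longrightarrow> b \<in> S \<Longrightarrow> j a \<le> j b \<longleftrightarrow> a \<le> b"
  using assms by (auto simp: ordered_embedding_on_def)

context valued_extension
begin

lemma embedding_nsmul:
  assumes "ordered_embedding_on (value_group v) j" "g \<in> value_group v"
  shows "j (nsmul n g) = nsmul n (j g)"
  by (induction n)
     (auto simp: ordered_embedding_onD[OF assms(1)] value_group_nsmul[OF val] assms(2))

lemma embedding_inverse:
  assumes "ordered_embedding_on (value_group v) j" "g \<in> value_group v"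
  shows "j g + j (- g) = 0"
  using ordered_embedding_onD(1,2)[OF assms(1)] value_group_uminus[OF val] assms(2)
  by (metis add.right_inverse)

lemma embedding_pos:
  assumes "ordered_embedding_on (value_group v) j" "g \<in> value_group v"
  shows "0 \<le> j g \<longleftrightarrow> 0 \<le> g" "j g \<le> 0 \<longleftrightarrow> g \<le> 0"
  using ordered_embedding_onD(1,3)[OF assms(1)] value_group_zero[OF val] assms(2) by metis+

section \<open>Values on the base field and the ring of a quasi-valuation\<close>

context
  fixes w :: "'e \<Rightarrow> 'm::{linorder, ordered_comm_monoid_add} with_infty" and j
  assumes qv: "quasi_valuation w"
    and emb: "ordered_embedding_on (value_group v) j" and ext: "extends_along j \<iota> v w"
begin

lemma qv_emb: "v a = Fin g \<Longrightarrow> w (\<iota> a) = Fin (j g)"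
  using ext by (simp add: extends_along_def)

lemma qv_one: "w 1 = 0"
  using qv_emb[of 1 0] valuation_one[OF val] ordered_embedding_onD(1)[OF emb]
  by (simp add: hom_one zero_with_infty_def)

lemma qv_emb_nonneg_iff: "0 \<le> w (\<iota> a) \<longleftrightarrow> 0 \<le> v a"
proof (cases "v a")
  case (Fin g)
  then show ?thesis
    using embedding_pos(1)[OF emb value_groupI[OF val Fin]] by (simp add: qv_emb)
next
  case Infty
  then show ?thesis using ext by (simp add: extends_along_def)
qed

text \<open>General products satisfy only an inequality, but nonzero elements of \<open>F\<close>
  have invertible values, and the inequality for \<open>inverse a\<close> supplies the
  converse.\<close>

lemma qv_scale: "w (\<iota> a * x) = w (\<iota> a) + w x"
proof (cases "a = 0")
  case True
  then show ?thesis by (simp add: emb_zero quasi_valuation_zero[OF qv])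
next
  case False
  then obtain g where g: "v a = Fin g" by (rule valuation_FinE[OF val])
  have 1: "w (\<iota> a) + w (\<iota> (inverse a)) = 0"
    using embedding_inverse[OF emb value_groupI[OF val g]] qv_emb[OF g]
      qv_emb[OF valuation_inverse[OF val g]] by (simp add: zero_with_infty_def)
  have "w (\<iota> (inverse a)) + w (\<iota> a * x) \<le> w (\<iota> (inverse a) * (\<iota> a * x))"
    by (rule quasi_valuation_mult[OF qv])
  also have "\<iota> (inverse a) * (\<iota> a * x) = x" using False by (simp add: emb_inverse)
  finally have "w (\<iota> a) + (w (\<iota> (inverse a)) + w (\<iota> a * x)) \<le> w (\<iota> a) + w x"
    by (rule add_left_mono)
  then have "w (\<iota> a * x) \<le> w (\<iota> a) + w x" using 1 by (simp add: add.assoc[symmetric])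
  then show ?thesis using quasi_valuation_mult[OF qv, of "\<iota> a" x] by (rule antisym)
qed

lemma qv_uminus: "w (- x) = w x"
proof -
  have "v (- 1) = Fin 0" using valuation_uminus[OF val, of 1] valuation_one[OF val] by (simp add: zero_with_infty_def)
  then have "w (\<iota> (- 1)) = 0" using qv_emb ordered_embedding_onD(1)[OF emb] by simp
  then show ?thesis using qv_scale[of "- 1" x] by (simp add: emb_uminus hom_one)
qed

text \<open>An infinite value of \<open>x\<close> would make \<open>w 1\<close> infinite, as
  \<open>x * inverse x = 1\<close>.\<close>

lemma qv_FinE:
  assumes "x \<noteq> 0" obtains m where "w x = Fin m" "m \<in> value_monoid w"
proof (cases "w x")
  case (Fin m)
  then show ?thesis using that value_monoid.generator[OF assms] by blast
next
  case Infty
  then show ?thesis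
    using quasi_valuation_mult[OF qv, of x "inverse x"] assms qv_one by (simp add: zero_with_infty_def)
qed

lemma qv_emb_value_monoid: "g \<in> value_group v \<Longrightarrow> j g \<in> value_monoid w"
  using qv_emb value_monoid.generator[of "\<iota> _" w] by (auto elim!: value_groupE)

lemma field_subring_qv_ring: "field_subring (qv_ring w)"
proof
  show "1 \<in> qv_ring w" by (simp add: qv_ring_def qv_one)
  fix x y assume "x \<in> qv_ring w" "y \<in> qv_ring w"
  then have xy: "0 \<le> w x" "0 \<le> w y" by (auto simp: qv_ring_def)
  show "x * y \<in> qv_ring w"
    using quasi_valuation_mult[OF qv, of x y] add_nonneg_nonneg[OF xy] by (auto simp: qv_ring_def)
  have "0 \<le> min (w x) (w (- y))" using xy qv_uminus by simp
  also have "\<dots> \<le> w (x - y)" using quasi_valuation_add[OF qv, of x "- y"] by simp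
  finally show "x - y \<in> qv_ring w" by (simp add: qv_ring_def)
qed

section \<open>Weak cancellativity: integral closedness, the Jacobson radical and torsion\<close>

context
  assumes wc: "weakly_cancellative (value_monoid w)"
begin

lemma integrally_closed_qv_ring:
  assumes exp: "exponential w" shows "integrally_closed (qv_ring w)"
  unfolding integrally_closed_def
proof
  fix x assume "x \<in> integral_closure (qv_ring w)"
  then obtain p where p: "lead_coeff p = 1" "\<And>i. 0 \<le> w (coeff p i)" "poly p x = 0"
    by (auto simp: integral_closure_def integral_over_def qv_ring_def)
  show "x \<in> qv_ring w"
  proof (rule ccontr)
    assume "x \<notin> qv_ring w"
    then have neg: "w x < 0" by (auto simp: qv_ring_def)
    have "x \<noteq> 0"
      using \<open>x \<notin> qv_ring w\<close> quasi_valuation_zero[OF qv] by (auto simp: qv_ring_def)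
    then obtain a where a: "w x = Fin a" "a \<in> value_monoid w" by (rule qv_FinE)
    have a0: "a \<le> 0" "a \<noteq> 0" using neg a(1) by (auto simp: zero_with_infty_def less_with_infty_def)
    have "degree p \<noteq> 0"
    proof
      assume "degree p = 0"
      then obtain c where "p = [:c:]" by (rule degree_eq_zeroE)
      then show False using p(1,3) by simp
    qed
    \<comment> \<open>\<open>k\<close> is one less than the degree: the terms below the top one have
      exponents at most \<open>k\<close> and hence, as \<open>w x < 0\<close>, values at least
      \<open>nsmul k (w x)\<close>.\<close>
    then obtain k where k: "degree p = Suc k" by (cases "degree p") auto
    have "(\<Sum>i\<le>k. coeff p i * x ^ i) + x ^ Suc k = 0"
      using p(1,3) k by (simp add: poly_altdef)
    then have eq: "x ^ Suc k = - (\<Sum>i\<le>k. coeff p i * x ^ i)"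
      by (simp add: eq_neg_iff_add_eq_0 add.commute)
    have "nsmul k (w x) \<le> w (coeff p i * x ^ i)" if "i \<in> {..k}" for i
    proof -
      have "nsmul k (w x) \<le> nsmul i (w x)" using that neg by (intro nsmul_antimono) auto
      also have "\<dots> = 0 + w (x ^ i)" using exp by (simp add: exponential_def)
      also have "\<dots> \<le> w (coeff p i) + w (x ^ i)" by (intro add_right_mono p(2))
      also have "\<dots> \<le> w (coeff p i * x ^ i)" by (rule quasi_valuation_mult[OF qv])
      finally show ?thesis .
    qed
    then have "nsmul k (w x) \<le> w (x ^ Suc k)"
      unfolding eq qv_uminus by (rule quasi_valuation_sum[OF qv])
    also have "\<dots> = nsmul (Suc k) (w x)" using exp by (simp only: exponential_def)
    \<comment> \<open>With \<open>a \<le> 0\<close> this squeezes \<open>nsmul k a + a\<close> to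
      \<open>nsmul k a\<close>, the form to which weak cancellativity applies.\<close>
    finally have "nsmul k a \<le> nsmul k a + a" using a(1) by (simp add: add.commute)
    moreover have "nsmul k a + a \<le> nsmul k a"
      using add_left_mono[OF a0(1), of "nsmul k a"] by simp
    ultimately have "nsmul k a + a = nsmul k a" by simp
    then have "a = 0"
      using wc a(2) value_monoid_nsmul[OF a(2), of k] by (auto simp: weakly_cancellative_def)
    then show False using a0(2) by simp
  qed
qed

text \<open>The inverse \<open>t\<close> satisfies \<open>t = 1 - \<iota> a * (y * t)\<close>. If
  \<open>w t\<close> were negative, the product would have value at most \<open>w t\<close>; its
  value is at least \<open>w t\<close> plus that of \<open>a\<close>. So \<open>w t\<close> would
  absorb a positive value, against weak cancellativity.\<close>

lemma qv_ring_jacobson: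
  assumes a: "0 < v a" and y: "y \<in> qv_ring w"
  shows "1 + \<iota> a * y \<noteq> 0 \<and> inverse (1 + \<iota> a * y) \<in> qv_ring w"
proof (cases "a = 0")
  case True
  then show ?thesis by (simp add: emb_zero qv_ring_def qv_one)
next
  case False
  then obtain g where g: "v a = Fin g" by (rule valuation_FinE[OF val])
  have jg: "j g \<in> value_monoid w" "0 < j g"
    using a g value_groupI[OF val g] embedding_pos[OF emb, of g]
    by (auto simp: qv_emb_value_monoid zero_with_infty_def less_with_infty_def less_le_not_le)
  have y: "0 \<le> w y" using y by (simp add: qv_ring_def)
  have prod: "Fin (j g) + w t \<le> w (\<iota> a * (y * t))" for t
  proof -
    have "Fin (j g) + (0 + w t) \<le> Fin (j g) + (w y + w t)"
      by (intro add_left_mono add_right_mono y)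
    also have "\<dots> \<le> Fin (j g) + w (y * t)"
      by (intro add_left_mono quasi_valuation_mult[OF qv])
    also have "\<dots> = w (\<iota> a * (y * t))" by (simp add: qv_scale qv_emb[OF g])
    finally show ?thesis by simp
  qed
  have nz: "1 + \<iota> a * y \<noteq> 0"
  proof
    assume "1 + \<iota> a * y = 0"
    then have "\<iota> a * y = - 1" by (simp add: eq_neg_iff_add_eq_0 add.commute)
    then show False using prod[of 1] jg(2) by (simp add: qv_uminus qv_one zero_with_infty_def)
  qed
  define t where "t = inverse (1 + \<iota> a * y)"
  have "t + \<iota> a * (y * t) = 1" using nz right_inverse[OF nz] by (simp add: t_def algebra_simps)
  then have t: "t = 1 + - (\<iota> a * (y * t))" by (simp add: algebra_simps)
  have "0 \<le> w t"
  proof (rule ccontr)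
    assume neg: "\<not> 0 \<le> w t"
    obtain s where s: "w t = Fin s" "s \<in> value_monoid w"
      using qv_FinE[of t] nz by (auto simp: t_def)
    have "min 0 (w (\<iota> a * (y * t))) \<le> w t"
      using quasi_valuation_add[OF qv, of 1 "- (\<iota> a * (y * t))"]
      unfolding t[symmetric] by (simp add: qv_one qv_uminus)
    then have "w (\<iota> a * (y * t)) \<le> w t" using neg by (auto simp: min_def split: if_splits)
    then have "Fin (j g) + w t \<le> w t" using prod[of t] by (rule order_trans[rotated])
    then have "s + j g \<le> s" using s(1) by (simp add: add.commute)
    moreover have "s \<le> s + j g" using jg(2) add_left_mono[of 0 "j g" s] by simp
    ultimately have "s + j g = s" by simp
    then have "j g = 0" using wc s(2) jg(1) by (auto simp: weakly_cancellative_def)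
    then show False using jg(2) by simp
  qed
  then show ?thesis using nz by (simp add: qv_ring_def t_def)
qed

text \<open>
  Weak cancellativity enters as \<open>i w(x) + b = i w(x) \<Longrightarrow> b = 0\<close>, where \<open>b\<close> is the value of the
  quotient of two terms of equal value in an algebraic equation for \<open>x\<close>.
\<close>

lemma value_torsion:
  assumes exp: "exponential w" and x: "x \<noteq> 0" "w x = Fin m"
  shows "\<exists>n>0. \<exists>g\<in>value_group v. nsmul n m = j g"
proof -
  obtain i l a b where il: "i < l" and ab: "a \<noteq> 0" "b \<noteq> 0"
    and le: "w (\<iota> b * x ^ l) \<le> w (\<iota> a * x ^ i)" "w (\<iota> a * x ^ i) \<le> w (\<iota> b * x ^ l)"
  proof (rule ex_comparable_powers[of "\<lambda>y x. w x \<le> w y"])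
    fix x y z
    show "w y \<le> w x \<or> w x \<le> w y" by auto
    show "w z \<le> w x" if "w y \<le> w x" "w z \<le> w y" using that by simp
    show "w z \<le> w (x + y)" if "w z \<le> w x" "w z \<le> w y"
      using that quasi_valuation_add[OF qv, of x y] by (meson min.boundedI order_trans)
    show "w x \<le> w (- x)" by (simp add: qv_uminus)
    show "\<not> w 0 \<le> w y" if "y \<noteq> 0"
      by (rule qv_FinE[OF that]) (simp add: quasi_valuation_zero[OF qv])
  next
    show "x \<noteq> 0" by fact
  next
    fix i l a b
    assume "i < l" "a \<noteq> 0" "b \<noteq> 0"
      "w (\<iota> b * x ^ l) \<le> w (\<iota> a * x ^ i)" "w (\<iota> a * x ^ i) \<le> w (\<iota> b * x ^ l)"
    then show thesis by (rule that)
  qed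
  obtain g h where gh: "v a = Fin g" "v b = Fin h" using ab val by (meson valuation_FinE)
  have G: "g \<in> value_group v" "h \<in> value_group v" using gh value_groupI[OF val] by auto
  have m: "m \<in> value_monoid w" using x by (rule value_monoid.generator)
  define k where "k = l - i"
  have "Fin (j g) + nsmul i (Fin m) = Fin (j h) + nsmul l (Fin m)"
    using antisym[OF le] exp by (simp add: qv_scale qv_emb[OF gh(1)] qv_emb[OF gh(2)] exponential_def x(2))
  then have eq: "j g + nsmul i m = j h + (nsmul i m + nsmul k m)"
    using il by (simp add: k_def flip: nsmul_add_left)
  \<comment> \<open>The monoid has no subtraction: negatives are formed in the value group of
    \<open>v\<close> and carried over by \<open>j\<close>.\<close>
  have jm: "j (h - g) = j h + j (- g)" "j (g - h) = j g + j (- h)"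
    using ordered_embedding_onD(2)[OF emb G(2) value_group_uminus[OF val G(1)]]
      ordered_embedding_onD(2)[OF emb G(1) value_group_uminus[OF val G(2)]] by simp_all
  have inv: "j g + j (- g) = 0" "j h + j (- h) = 0"
    using embedding_inverse[OF emb] G by auto
  have "nsmul i m + (nsmul k m + j (h - g)) = (j h + (nsmul i m + nsmul k m)) + j (- g)"
    by (simp add: jm add_ac)
  also have "\<dots> = nsmul i m + (j g + j (- g))" by (simp add: eq[symmetric] add_ac)
  finally have "nsmul i m + (nsmul k m + j (h - g)) = nsmul i m" by (simp add: inv)
  moreover have "nsmul k m + j (h - g) \<in> value_monoid w"
    using m G by (intro value_monoid.add value_monoid_nsmul qv_emb_value_monoid value_group_diff[OF val])
  ultimately have 0: "nsmul k m + j (h - g) = 0"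
    using wc value_monoid_nsmul[OF m, of i] by (auto simp: weakly_cancellative_def)
  have "nsmul k m = nsmul k m + (j g + j (- g)) + (j h + j (- h))" by (simp add: inv)
  also have "\<dots> = (nsmul k m + j (h - g)) + j (g - h)" by (simp add: jm add_ac)
  also have "\<dots> = j (g - h)" by (simp add: 0)
  finally have "nsmul k m = j (g - h)" .
  moreover have "0 < k" using il by (simp add: k_def)
  ultimately show ?thesis using value_group_diff[OF val G] by blast
qed

section \<open>From torsion to an embedding into the divisible hull\<close>

lemma value_monoid_torsion:
  assumes exp: "exponential w" and "m \<in> value_monoid w"
  shows "\<exists>n>0. \<exists>g\<in>value_group v. nsmul n m = j g"
  using assms(2)
proof induction
  case (generator x m)
  then show ?case by (rule value_torsion[OF exp])
next
  case zero
  show ?case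
    by (intro exI[of _ "1::nat"] conjI bexI[of _ 0] value_group_zero[OF val])
       (simp_all add: ordered_embedding_onD(1)[OF emb])
next
  case (add m m')
  then obtain n g n' g' where n: "0 < n" "nsmul n m = j g" "0 < n'" "nsmul n' m' = j g'"
    and g: "g \<in> value_group v" "g' \<in> value_group v" by blast
  have "nsmul (n * n') (m + m') = nsmul n' (nsmul n m) + nsmul n (nsmul n' m')"
    unfolding nsmul_add nsmul_mult by (simp add: nsmul_commute)
  also have "\<dots> = j (nsmul n' g + nsmul n g')"
    by (simp add: n g ordered_embedding_onD(2)[OF emb] value_group_nsmul[OF val] embedding_nsmul[OF emb])
  finally show ?case
    using n g by (intro exI[of _ "n * n'"] conjI bexI[of _ "nsmul n' g + nsmul n g'"]
        value_group_add[OF val] value_group_nsmul[OF val]) auto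
qed

text \<open>Torsion makes \<open>m'\<close> invertible, since a multiple of it is the value of an
  element of \<open>F\<close>. If \<open>m' < m\<close>, adding the inverse \<open>r\<close> gives
  \<open>m + r \<ge> 0\<close> with a vanishing positive multiple, so \<open>m + r = 0\<close> and
  \<open>m = m'\<close>.\<close>

lemma nsmul_le_cancel:
  assumes exp: "exponential w" and m: "m' \<in> value_monoid w"
    and n: "0 < n" "nsmul n m \<le> nsmul n m'"
  shows "m \<le> m'"
proof (rule ccontr)
  assume "\<not> m \<le> m'"
  then have less: "m' < m" by simp
  obtain k g where k: "0 < k" "g \<in> value_group v" "nsmul k m' = j g"
    using value_monoid_torsion[OF exp m] by blast
  define r where "r = nsmul (k - 1) m' + j (- g)"
  have "m' + r = nsmul k m' + j (- g)" using k(1) by (cases k) (simp_all add: r_def add_ac)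
  also have "\<dots> = 0" using k embedding_inverse[OF emb] by simp
  finally have r: "m' + r = 0" .
  have pos: "0 \<le> m + r" using add_right_mono[of m' m r] less r by simp
  have "nsmul n m' \<le> nsmul n m" using less by (intro nsmul_mono_monoid) simp
  then have "nsmul n m = nsmul n m'" using n(2) by simp
  then have "nsmul n (m + r) = nsmul n (m' + r)" by (simp only: nsmul_add)
  then have "nsmul n (m + r) = 0" by (simp add: r)
  moreover have "m + r \<le> nsmul n (m + r)"
    using n(1) pos add_left_mono[OF nsmul_mono_monoid[OF pos, of "n - 1"], of "m + r"] by (cases n) auto
  ultimately have "m + r = 0" using pos by simp
  then have "m' = m' + (m + r)" by simp
  also have "\<dots> = m + (m' + r)" by (simp add: add_ac)
  also have "\<dots> = m" by (simp add: r)
  finally show False using less by simp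
qed

text \<open>Each \<open>m\<close> has a multiple in the value group and is sent to the corresponding
  fraction in the hull. Divisibility gives existence of the fraction, and \<open>rel_le\<close> its
  uniqueness.\<close>

lemma ex_hull_embedding:
  assumes exp: "exponential w"
  shows "\<exists>e. regarded_in_div_hull \<iota> v w (\<lambda>x. map_with_infty e (w x))"
proof -
  define rel where "rel m d \<longleftrightarrow> (\<exists>n>0. \<exists>g\<in>value_group v. nsmul n m = j g \<and> nsmul n d = to_div_hull g)"
    for m d
  define e where "e m = (SOME d. rel m d)" for m
  have e: "rel m (e m)" if "m \<in> value_monoid w" for m
  proof -
    obtain n g where n: "0 < n" "g \<in> value_group v" "nsmul n m = j g"
      using value_monoid_torsion[OF exp \<open>m \<in> value_monoid w\<close>] by blast
    moreover obtain d where "nsmul n d = to_div_hull g" using div_hull_divisible[OF n(1)] by blast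
    ultimately show ?thesis unfolding e_def by (intro someI[of "rel m" d]) (auto simp: rel_def)
  qed
  \<comment> \<open>Clearing both denominators moves the comparison into the value group. The
    equivalence yields independence of the choices as well as the order embedding.\<close>
  have rel_le: "d \<le> d' \<longleftrightarrow> m \<le> m'"
    if m: "m' \<in> value_monoid w" and rel: "rel m d" "rel m' d'" for m m' d d'
  proof -
    obtain n g n' g' where n: "0 < n" "nsmul n m = j g" "nsmul n d = to_div_hull g"
       "0 < n'" "nsmul n' m' = j g'" "nsmul n' d' = to_div_hull g'"
      and g: "g \<in> value_group v" "g' \<in> value_group v"
      using rel by (auto simp: rel_def)
    have "d \<le> d' \<longleftrightarrow> nsmul (n' * n) d \<le> nsmul (n * n') d'"
      using n by (simp add: mult.commute)
    also have "\<dots> \<longleftrightarrow> nsmul n' g \<le> nsmul n g'"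
      by (simp only: nsmul_mult n to_div_hull_nsmul[symmetric] to_div_hull_le_iff)
    also have "\<dots> \<longleftrightarrow> j (nsmul n' g) \<le> j (nsmul n g')"
      by (simp add: ordered_embedding_onD(3)[OF emb] value_group_nsmul[OF val] g)
    also have "\<dots> \<longleftrightarrow> nsmul (n' * n) m \<le> nsmul (n' * n) m'"
      by (simp only: mult.commute[of n' n] nsmul_mult n(5) embedding_nsmul[OF emb] g)
         (simp only: nsmul_commute[of n n'] n(2))
    also have "\<dots> \<longleftrightarrow> m \<le> m'"
      using n m by (auto intro: nsmul_le_cancel[OF exp m, of "n' * n"] nsmul_mono_monoid)
    finally show ?thesis .
  qed
  have e_eq: "e m = d" if "m \<in> value_monoid w" "rel m d" for m d
    using rel_le[OF that(1) e[OF that(1)] that(2)] rel_le[OF that(1) that(2) e[OF that(1)]] by simp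
  have rel_zero: "rel 0 0"
    unfolding rel_def using value_group_zero[OF val] ordered_embedding_onD(1)[OF emb]
    by (intro exI[of _ "1::nat"] conjI bexI[of _ 0]) (auto simp: to_div_hull_zero)
  have rel_emb: "rel (j g) (to_div_hull g)" if "g \<in> value_group v" for g
    unfolding rel_def using that by (intro exI[of _ "1::nat"] conjI bexI[of _ g]) auto
  have rel_add: "rel (m + m') (d + d')" if rel: "rel m d" "rel m' d'" for m m' d d'
  proof -
    obtain n g n' g' where n: "0 < n" "nsmul n m = j g" "nsmul n d = to_div_hull g"
       "0 < n'" "nsmul n' m' = j g'" "nsmul n' d' = to_div_hull g'"
      and g: "g \<in> value_group v" "g' \<in> value_group v"
      using rel by (auto simp: rel_def)
    have "nsmul (n * n') (m + m') = nsmul n' (nsmul n m) + nsmul n (nsmul n' m')"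
      unfolding nsmul_add nsmul_mult by (simp add: nsmul_commute)
    also have "\<dots> = j (nsmul n' g + nsmul n g')"
      by (simp add: n g ordered_embedding_onD(2)[OF emb] value_group_nsmul[OF val] embedding_nsmul[OF emb])
    finally have 1: "nsmul (n * n') (m + m') = j (nsmul n' g + nsmul n g')" .
    have "nsmul (n * n') (d + d') = nsmul n' (nsmul n d) + nsmul n (nsmul n' d')"
      unfolding nsmul_add nsmul_mult by (simp add: nsmul_commute)
    also have "\<dots> = to_div_hull (nsmul n' g + nsmul n g')"
      by (simp add: n to_div_hull_nsmul to_div_hull_add)
    finally show ?thesis unfolding rel_def
      using 1 n g by (intro exI[of _ "n * n'"] conjI bexI[of _ "nsmul n' g + nsmul n g'"]
          value_group_add[OF val] value_group_nsmul[OF val]) auto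
  qed
  have "ordered_embedding_on (value_monoid w) e"
    unfolding ordered_embedding_on_def
    using e_eq[OF value_monoid.zero rel_zero] e_eq[OF value_monoid.add rel_add[OF e e]] rel_le[OF _ e e]
    by blast
  moreover have "hull_extension \<iota> v (\<lambda>x. map_with_infty e (w x))"
    unfolding hull_extension_def extends_along_def
  proof (intro conjI allI impI)
    fix a
    show "map_with_infty e (w (\<iota> a)) = map_with_infty to_div_hull (v a)"
    proof (cases "v a")
      case (Fin g)
      note g = value_groupI[OF val Fin]
      show ?thesis using qv_emb[OF Fin] Fin e_eq[OF qv_emb_value_monoid[OF g] rel_emb[OF g]] by simp
    next
      case Infty
      then show ?thesis using ext by (simp add: extends_along_def)
    qed
  next
    fix x d assume d: "map_with_infty e (w x) = Fin d"
    then obtain m where m: "w x = Fin m" "d = e m" by (cases "w x") auto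
    then have "x \<noteq> 0" using quasi_valuation_zero[OF qv] by auto
    then have "rel m d" using e[OF value_monoid.generator] m by blast
    then show "d \<in> value_div_hull v" unfolding rel_def value_div_hull_def by blast
  qed
  ultimately show ?thesis unfolding regarded_in_div_hull_def by blast
qed

end

end
lemma transport_exponential:
  fixes w :: "'e \<Rightarrow> 'm::{linorder, ordered_comm_monoid_add} with_infty"
  assumes qv: "quasi_valuation w" and exp: "exponential w" and reg: "regarded_in_div_hull \<iota> v w w'"
  shows "w' \<in> exponential_extensions \<iota> v \<and> qv_ring w' = qv_ring w"
proof -
  obtain e where hull: "hull_extension \<iota> v w'" and e: "ordered_embedding_on (value_monoid w) e"
    and w': "\<And>x. w' x = map_with_infty e (w x)"
    using reg by (auto simp: regarded_in_div_hull_def)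
  note eD = ordered_embedding_onD[OF e]
  have mem: "m \<in> value_monoid w" if "w x = Fin m" for x m
    using that quasi_valuation_zero[OF qv] value_monoid.generator[of x w m] by (cases "x = 0") auto
  have le: "w' x \<le> w' y \<longleftrightarrow> w x \<le> w y" for x y
    by (cases "w x"; cases "w y") (auto simp: w' eD(3) mem)
  have add: "map_with_infty e (w x + w y) = w' x + w' y" for x y
    by (cases "w x"; cases "w y") (auto simp: w' eD(2) mem)
  \<comment> \<open>A sum of two values need not be a value, but it lies in the value monoid, where
    \<open>e\<close> still preserves and reflects the order.\<close>
  have map_mono: "map_with_infty e (w x + w y) \<le> w' z \<longleftrightarrow> w x + w y \<le> w z" for x y z
    by (cases "w x"; cases "w y"; cases "w z") (auto simp: w' eD(3) mem value_monoid.add)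
  have "quasi_valuation w'"
    unfolding quasi_valuation_def
  proof (intro conjI allI)
    show "w' 0 = Infty" by (simp add: w' quasi_valuation_zero[OF qv])
    fix x y
    show "w' x + w' y \<le> w' (x * y)"
      using map_mono[of x y "x * y"] add[of x y] quasi_valuation_mult[OF qv, of x y] by simp
    show "min (w' x) (w' y) \<le> w' (x + y)"
      using quasi_valuation_add[OF qv, of x y] by (auto simp: min_le_iff_disj le)
  qed
  \<comment> \<open>Cancellation is automatic, the hull being a group.\<close>
  moreover have "weakly_cancellative (value_monoid w')"
    by (simp add: weakly_cancellative_def)
  moreover have "exponential w'"
    unfolding exponential_def
  proof (intro allI)
    fix x n
    have "e (nsmul n m) = nsmul n (e m)" if "m \<in> value_monoid w" for m
      by (induction n) (auto simp: eD(1,2) value_monoid_nsmul that)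
    then have "map_with_infty e (nsmul n (w x)) = nsmul n (map_with_infty e (w x))"
      using mem eD(1) by (cases "w x"; cases n) (auto simp: zero_with_infty_def simp del: nsmul.simps(2))
    then show "w' (x ^ n) = nsmul n (w' x)"
      using exp by (simp add: w' exponential_def)
  qed
  moreover have "qv_ring w' = qv_ring w"
  proof -
    have "0 \<le> w' x \<longleftrightarrow> 0 \<le> w x" for x
      using eD(1) eD(3)[OF value_monoid.zero mem] by (cases "w x") (auto simp: w')
    then show ?thesis by (simp add: qv_ring_def)
  qed
  ultimately show ?thesis using hull by (simp add: exponential_extensions_def)
qed

end

section \<open>Exponential quasi-valuations in the divisible hull\<close>

context valued_extension
begin

lemma to_div_hull_embedding: "ordered_embedding_on (value_group v) to_div_hull"
  by (simp add: ordered_embedding_on_def to_div_hull_zero to_div_hull_add to_div_hull_le_iff)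

lemma wc_quasi_extensionE:
  assumes "wc_quasi_extension \<iota> v w"
  obtains j where "quasi_valuation w" "ordered_embedding_on (value_group v) j"
    "extends_along j \<iota> v w" "weakly_cancellative (value_monoid w)"
  using assms unfolding wc_quasi_extension_def extends_valuation_def by blast

lemma exponential_extension_wc:
  "w \<in> exponential_extensions \<iota> v \<Longrightarrow> wc_quasi_extension \<iota> v w \<and> exponential w"
  using to_div_hull_embedding
  by (auto simp: exponential_extensions_def wc_quasi_extension_def extends_valuation_def hull_extension_def)

lemma integrally_closed_exponential:
  assumes "wc_quasi_extension \<iota> v w" "exponential w"
  shows "integrally_closed (qv_ring w)"
  using wc_quasi_extensionE[OF assms(1)] integrally_closed_qv_ring assms(2) by metis

lemma exponential_le_iff:
  assumes w: "w \<in> exponential_extensions \<iota> v"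
    and n: "0 < n" "v c = Fin g" "nsmul n d = to_div_hull g"
  shows "Fin d \<le> w x \<longleftrightarrow> \<iota> (inverse c) * x ^ n \<in> qv_ring w"
proof -
  have qv: "quasi_valuation w" and ext: "extends_along to_div_hull \<iota> v w" and exp: "exponential w"
    using w by (auto simp: exponential_extensions_def hull_extension_def)
  have "w (\<iota> (inverse c) * x ^ n) = Fin (to_div_hull (- g)) + nsmul n (w x)"
    using exp unfolding qv_scale[OF qv to_div_hull_embedding ext]
      qv_emb[OF qv to_div_hull_embedding ext valuation_inverse[OF val n(2)]]
    by (simp add: exponential_def)
  moreover have "0 \<le> Fin (to_div_hull (- g)) + nsmul n (w x) \<longleftrightarrow> Fin d \<le> w x"
  proof (cases "w x")
    case (Fin e)
    have "0 \<le> to_div_hull (- g) + nsmul n e \<longleftrightarrow> nsmul n d \<le> nsmul n e"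
      by (simp add: to_div_hull_uminus n(3))
    then show ?thesis using Fin n(1) by simp
  qed (use n(1) in simp)
  ultimately show ?thesis by (simp add: qv_ring_def)
qed

lemma exponential_unique:
  assumes w: "w \<in> exponential_extensions \<iota> v" "w' \<in> exponential_extensions \<iota> v"
    and eq: "qv_ring w = qv_ring w'"
  shows "w = w'"
proof
  fix x
  have le: "w1 x \<le> w2 x"
    if w: "w1 \<in> exponential_extensions \<iota> v" "w2 \<in> exponential_extensions \<iota> v"
      and eq: "qv_ring w1 = qv_ring w2" and x: "x \<noteq> 0" for w1 w2
  proof -
    have qv: "quasi_valuation w1" and hull: "hull_extension \<iota> v w1"
      and ext: "extends_along to_div_hull \<iota> v w1"
      using w(1) by (auto simp: exponential_extensions_def hull_extension_def)
    obtain d where d: "w1 x = Fin d"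
      using qv_FinE[OF qv to_div_hull_embedding ext x] by blast
    then have "d \<in> value_div_hull v" using hull by (auto simp: hull_extension_def)
    then obtain n g where n: "0 < n" "nsmul n d = to_div_hull g" and g: "g \<in> value_group v"
      by (auto simp: value_div_hull_def)
    obtain c where c: "v c = Fin g" using g by (rule value_groupE)
    \<comment> \<open>\<open>Fin d \<le> w1 x\<close> holds by the choice of \<open>d\<close>, so
      the test element lies in the common ring and the criterion for \<open>w2\<close>
      applies.\<close>
    show ?thesis
      using exponential_le_iff[OF w(1) n(1) c n(2), of x] exponential_le_iff[OF w(2) n(1) c n(2), of x]
      by (simp add: d eq)
  qed
  show "w x = w' x"
  proof (cases "x = 0")
    case True
    then show ?thesis using w by (simp add: exponential_extensions_def quasi_valuation_zero)
  next
    case False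
    then show ?thesis using le[OF w eq] le[OF w(2,1) eq[symmetric]] by simp
  qed
qed

text \<open>The minimum is exponential because an index attaining it at \<open>x\<close> bounds it
  at the powers of \<open>x\<close>; on \<open>F\<close> all the valuations agree.\<close>

lemma Min_valuations:
  fixes u :: "'i \<Rightarrow> 'e \<Rightarrow> 'g div_hull with_infty"
  assumes K: "finite K" "K \<noteq> {}"
    and u: "\<And>i. i \<in> K \<Longrightarrow> valuation (u i)" "\<And>i. i \<in> K \<Longrightarrow> hull_extension \<iota> v (u i)"
  shows "(\<lambda>x. Min ((\<lambda>i. u i x) ` K)) \<in> exponential_extensions \<iota> v"
    and "qv_ring (\<lambda>x. Min ((\<lambda>i. u i x) ` K)) = (\<Inter>i\<in>K. qv_ring (u i))"
proof -
  define m where "m x = Min ((\<lambda>i. u i x) ` K)" for x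
  have m_le: "m x \<le> u i x" if "i \<in> K" for i x
    unfolding m_def using K that by (intro Min_le) auto
  have m_ge: "c \<le> m x" if "\<And>i. i \<in> K \<Longrightarrow> c \<le> u i x" for c x
    unfolding m_def using K that by (intro Min.boundedI) auto
  have m_in: "\<exists>i\<in>K. m x = u i x" for x
  proof -
    have "m x \<in> (\<lambda>i. u i x) ` K" unfolding m_def using K by (intro Min_in) auto
    then show ?thesis by blast
  qed
  have "quasi_valuation m"
    unfolding quasi_valuation_def
  proof (intro conjI allI)
    show "m 0 = Infty" using m_in[of 0] u(1) by (auto simp: valuation_zero_iff)
    fix x y
    show "m x + m y \<le> m (x * y)"
      by (rule m_ge) (simp add: valuation_mult[OF u(1)] add_mono m_le)
    show "min (m x) (m y) \<le> m (x + y)"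
    proof (rule m_ge)
      fix i assume i: "i \<in> K"
      have "min (m x) (m y) \<le> min (u i x) (u i y)" using m_le[OF i] by (intro min.mono)
      also have "\<dots> \<le> u i (x + y)" by (rule valuation_add[OF u(1)[OF i]])
      finally show "min (m x) (m y) \<le> u i (x + y)" .
    qed
  qed
  moreover have "hull_extension \<iota> v m"
    unfolding hull_extension_def extends_along_def
  proof (intro conjI allI impI)
    show "m (\<iota> a) = map_with_infty to_div_hull (v a)" for a
      using m_in[of "\<iota> a"] u(2) by (auto simp: hull_extension_def extends_along_def)
    show "d \<in> value_div_hull v" if "m x = Fin d" for x d
      using m_in[of x] u(2) that by (auto simp: hull_extension_def)
  qed
  moreover have "exponential m"
    unfolding exponential_def
  proof (intro allI antisym)
    fix x n
    obtain i where i: "i \<in> K" "m x = u i x" using m_in by blast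
    show "m (x ^ n) \<le> nsmul n (m x)"
      using m_le[OF i(1), of "x ^ n"] i(2) by (simp add: valuation_power[OF u(1)[OF i(1)]])
    show "nsmul n (m x) \<le> m (x ^ n)"
      by (rule m_ge) (simp add: valuation_power[OF u(1)] nsmul_mono_monoid m_le)
  qed
  ultimately show "(\<lambda>x. Min ((\<lambda>i. u i x) ` K)) \<in> exponential_extensions \<iota> v"
    by (simp add: exponential_extensions_def weakly_cancellative_def m_def[abs_def])
  have "0 \<le> m x \<longleftrightarrow> (\<forall>i\<in>K. 0 \<le> u i x)" for x
    using m_ge[of 0 x] order_trans[OF _ m_le, of 0 x] by auto
  then show "qv_ring (\<lambda>x. Min ((\<lambda>i. u i x) ` K)) = (\<Inter>i\<in>K. qv_ring (u i))"
    unfolding qv_ring_def m_def[symmetric] by auto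
qed

section \<open>Valuations cutting out an integrally closed quasi-valuation ring\<close>

lemma ex_valuations:
  assumes w: "wc_quasi_extension \<iota> v w" and closed: "integrally_closed (qv_ring w)"
  shows "\<exists>(k::nat) u. 1 \<le> k \<and> (\<forall>i\<in>{1..k}. valuation (u i) \<and> hull_extension \<iota> v (u i)) \<and>
    qv_ring w = (\<Inter>i\<in>{1..k}. qv_ring (u i))"
proof -
  obtain j where j: "quasi_valuation w" "ordered_embedding_on (value_group v) j"
    "extends_along j \<iota> v w" and wc: "weakly_cancellative (value_monoid w)"
    using w by (rule wc_quasi_extensionE)
  define R where "R = qv_ring w"
  interpret R: field_subring R unfolding R_def by (rule field_subring_qv_ring[OF j])
  have base: "\<iota> a \<in> R \<longleftrightarrow> 0 \<le> v a" for a
    using qv_emb_nonneg_iff[OF j] by (simp add: R_def qv_ring_def)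
  define S where "S = {V. lies_over V \<and> R \<subseteq> V}"
  have avoid: "\<exists>V\<in>S. x \<notin> V" if "x \<notin> R" for x
  proof (rule ex_lies_over_avoiding[OF R.field_subring_axioms _ _ that])
    show "\<iota> a \<in> R" if "0 \<le> v a" for a using base that by simp
    show "integrally_closed R" using closed by (simp add: R_def)
    show "1 + \<iota> a * y \<noteq> 0 \<and> inverse (1 + \<iota> a * y) \<in> R" if "0 < v a" "y \<in> R" for a y
      using qv_ring_jacobson[OF j wc] that by (simp add: R_def)
  qed (auto simp: S_def)
  have finite: "finite S" by (rule finite_subset[OF _ finite_lies_over]) (auto simp: S_def)
  have "S \<noteq> {}"
  \<comment> \<open>When \<open>R\<close> is all of \<open>E\<close> there is no element to avoid,
    but \<open>R\<close> itself lies over \<open>v\<close>. So the index set is nonempty, as the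
    minimum requires.\<close>
  proof (cases "R = UNIV")
    case True
    have "lies_over R"
      unfolding lies_over_def valuation_ring_def valuation_ring_axioms_def
      using base True R.field_subring_axioms by simp
    then show ?thesis by (auto simp: S_def)
  qed (use avoid in blast)
  obtain h where h: "bij_betw h {1..card S} S"
    using ex_bij_betw_nat_finite_1[OF finite] by blast
  have hS: "h ` {1..card S} = S" using h by (rule bij_betw_imp_surj_on)
  have "1 \<le> card S" using finite \<open>S \<noteq> {}\<close> by (simp add: Suc_le_eq card_gt_0_iff)
  moreover have over: "lies_over (h i)" if "i \<in> {1..card S}" for i
    using hS that by (auto simp: S_def)
  moreover have "R = (\<Inter>i\<in>{1..card S}. qv_ring (ring_valuation (h i)))"
  proof -
    have "(\<Inter>i\<in>{1..card S}. qv_ring (ring_valuation (h i))) = (\<Inter>i\<in>{1..card S}. h i)"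
      by (intro INF_cong refl qv_ring_ring_valuation over)
    also have "\<dots> = \<Inter>S" by (simp only: hS)
    also have "\<dots> = R" using avoid by (auto simp: S_def)
    finally show ?thesis by simp
  qed
  ultimately show ?thesis
    by (intro exI[of _ "card S"] exI[of _ "\<lambda>i. ring_valuation (h i)"])
       (simp add: R_def valuation_ring_valuation hull_extension_ring_valuation)
qed

text \<open>Every transported copy of \<open>w\<close> is exponential with the same ring, hence
  equal to \<open>m\<close>; the existence of an embedding gives the other direction.\<close>

lemma regarded_iff:
  assumes w: "wc_quasi_extension \<iota> v w" "exponential w"
    and m: "m \<in> exponential_extensions \<iota> v" "qv_ring w = qv_ring m"
  shows "regarded_in_div_hull \<iota> v w w' \<longleftrightarrow> w' = m"
proof -
  obtain j where j: "quasi_valuation w" "ordered_embedding_on (value_group v) j"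
    "extends_along j \<iota> v w" and wc: "weakly_cancellative (value_monoid w)"
    using w(1) by (rule wc_quasi_extensionE)
  have *: "w' = m" if "regarded_in_div_hull \<iota> v w w'" for w'
    using transport_exponential[OF j(1) w(2) that] m exponential_unique by metis
  obtain e where e: "regarded_in_div_hull \<iota> v w (\<lambda>x. map_with_infty e (w x))"
    using ex_hull_embedding[OF j wc w(2)] by blast
  show ?thesis using * e by metis
qed

lemma ex_exponential_extension:
  assumes "wc_quasi_extension \<iota> v w" "integrally_closed (qv_ring w)"
  shows "\<exists>m\<in>exponential_extensions \<iota> v. qv_ring m = qv_ring w"
proof -
  obtain k :: nat and u where "1 \<le> k" "\<And>i. i \<in> {1..k} \<Longrightarrow> valuation (u i)"
    "\<And>i. i \<in> {1..k} \<Longrightarrow> hull_extension \<iota> v (u i)" "qv_ring w = (\<Inter>i\<in>{1..k}. qv_ring (u i))"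
    using ex_valuations[OF assms] by blast
  then show ?thesis using Min_valuations[of "{1..k}" u] by (intro bexI) auto
qed

end

text \<open>Rings coming from the hull itself belong to the target because the carrier
  \<open>'m\<close> may be too small to realize every exponential quasi-valuation. The type
  variables \<open>'m\<close> and \<open>'n\<close> stand for arbitrary monoids.\<close>

theorem corollary7p8:
  fixes \<iota> :: "'f::field \<Rightarrow> 'e::field"
    and v :: "'f \<Rightarrow> 'g::linordered_ab_group_add with_infty"
  assumes "finite_field_extension \<iota>" and "valuation v"
  shows
    "(\<forall>w :: 'e \<Rightarrow> 'm::{linorder, ordered_comm_monoid_add} with_infty.
        wc_quasi_extension \<iota> v w \<and> exponential w \<longrightarrow> integrally_closed (qv_ring w)) \<and>
     (\<forall>w :: 'e \<Rightarrow> 'm with_infty.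
        wc_quasi_extension \<iota> v w \<and> integrally_closed (qv_ring w) \<longrightarrow>
        qv_ring w = integral_closure (qv_ring w) \<and>
        (\<exists>(k::nat) (u :: nat \<Rightarrow> 'e \<Rightarrow> 'g div_hull with_infty).
           1 \<le> k \<and>
           (\<forall>i\<in>{1..k}. valuation (u i) \<and> hull_extension \<iota> v (u i)) \<and>
           qv_ring w = (\<Inter>i\<in>{1..k}. qv_ring (u i)) \<and>
           (let u_min = (\<lambda>x. Min ((\<lambda>i. u i x) ` {1..k})) in
              {w' \<in> exponential_extensions \<iota> v. qv_ring w' = qv_ring w} = {u_min} \<and>
              (\<forall>w' :: 'e \<Rightarrow> 'n::{linorder, ordered_comm_monoid_add} with_infty.
                 wc_quasi_extension \<iota> v w' \<and> exponential w' \<and> qv_ring w' = qv_ring w \<longrightarrow>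
                 (\<forall>w''. regarded_in_div_hull \<iota> v w' w'' \<longleftrightarrow> w'' = u_min))))) \<and>
     bij_betw qv_ring (exponential_extensions \<iota> v)
       {R \<in> qv_rings \<iota> v TYPE('m) \<union> qv_rings \<iota> v TYPE('g div_hull). integrally_closed R}"
proof (intro conjI allI impI)
  interpret valued_extension \<iota> v
    using assms by (intro valued_extension.intro valued_extension_axioms.intro)
  show "integrally_closed (qv_ring w)" if "wc_quasi_extension \<iota> v w \<and> exponential w"
    for w :: "'e \<Rightarrow> 'm with_infty"
    using that integrally_closed_exponential by blast
  show "bij_betw qv_ring (exponential_extensions \<iota> v)
    {R \<in> qv_rings \<iota> v TYPE('m) \<union> qv_rings \<iota> v TYPE('g div_hull). integrally_closed R}"
    unfolding bij_betw_def
  proof (intro conjI inj_onI equalityI subsetI)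
    fix R assume "R \<in> qv_ring ` exponential_extensions \<iota> v"
    then obtain w where "R = qv_ring w" "w \<in> exponential_extensions \<iota> v"
      by blast
    moreover from this have "wc_quasi_extension \<iota> v w" "exponential w"
      using exponential_extension_wc by auto
    ultimately show "R \<in> {R \<in> qv_rings \<iota> v TYPE('m) \<union> qv_rings \<iota> v TYPE('g div_hull). integrally_closed R}"
      using integrally_closed_exponential by (auto simp: qv_rings_def)
  next
    fix R assume "R \<in> {R \<in> qv_rings \<iota> v TYPE('m) \<union> qv_rings \<iota> v TYPE('g div_hull). integrally_closed R}"
    then have closed: "integrally_closed R"
      and "R \<in> qv_rings \<iota> v TYPE('m) \<or> R \<in> qv_rings \<iota> v TYPE('g div_hull)"
      by auto
    then consider (monoid) w :: "'e \<Rightarrow> 'm with_infty" where "wc_quasi_extension \<iota> v w" "R = qv_ring w"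
      | (hull) w :: "'e \<Rightarrow> 'g div_hull with_infty" where "wc_quasi_extension \<iota> v w" "R = qv_ring w"
      by (auto simp: qv_rings_def)
    then show "R \<in> qv_ring ` exponential_extensions \<iota> v"
    proof cases
      case monoid
      then show ?thesis using ex_exponential_extension[of w] closed by auto
    next
      case hull
      then show ?thesis using ex_exponential_extension[of w] closed by auto
    qed
  qed (rule exponential_unique)
  fix w :: "'e \<Rightarrow> 'm with_infty"
  assume "wc_quasi_extension \<iota> v w \<and> integrally_closed (qv_ring w)"
  then have w: "wc_quasi_extension \<iota> v w" and closed: "integrally_closed (qv_ring w)" by auto
  obtain j where "quasi_valuation w" "ordered_embedding_on (value_group v) j" "extends_along j \<iota> v w"
    using w by (rule wc_quasi_extensionE)
  then have "qv_ring w \<subseteq> integral_closure (qv_ring w)"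
    by (intro field_subring.subset_integral_closure field_subring_qv_ring)
  then show "qv_ring w = integral_closure (qv_ring w)"
    using closed by (auto simp: integrally_closed_def)
  obtain k :: nat and u where u: "1 \<le> k" "\<forall>i\<in>{1..k}. valuation (u i) \<and> hull_extension \<iota> v (u i)"
    "qv_ring w = (\<Inter>i\<in>{1..k}. qv_ring (u i))"
    using ex_valuations[OF w closed] by blast
  define u_min where "u_min = (\<lambda>x. Min ((\<lambda>i. u i x) ` {1..k}))"
  have min: "u_min \<in> exponential_extensions \<iota> v" "qv_ring u_min = qv_ring w"
    unfolding u_min_def u(3) using u(1,2) by (intro Min_valuations; simp)+
  have "{w' \<in> exponential_extensions \<iota> v. qv_ring w' = qv_ring w} = {u_min}"
    using min exponential_unique by auto
  moreover have "regarded_in_div_hull \<iota> v w' w'' \<longleftrightarrow> w'' = u_min"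
    if "wc_quasi_extension \<iota> v w'" "exponential w'" "qv_ring w' = qv_ring w"
    for w' :: "'e \<Rightarrow> 'n with_infty" and w''
    using that min by (intro regarded_iff) auto
  ultimately have "{w' \<in> exponential_extensions \<iota> v. qv_ring w' = qv_ring w} = {u_min} \<and>
      (\<forall>w' :: 'e \<Rightarrow> 'n with_infty.
         wc_quasi_extension \<iota> v w' \<and> exponential w' \<and> qv_ring w' = qv_ring w \<longrightarrow>
         (\<forall>w''. regarded_in_div_hull \<iota> v w' w'' \<longleftrightarrow> w'' = u_min))"
    by simp
  with u show "\<exists>(k::nat) (u :: nat \<Rightarrow> 'e \<Rightarrow> 'g div_hull with_infty).
           1 \<le> k \<and>
           (\<forall>i\<in>{1..k}. valuation (u i) \<and> hull_extension \<iota> v (u i)) \<and>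
           qv_ring w = (\<Inter>i\<in>{1..k}. qv_ring (u i)) \<and>
           (let u_min = (\<lambda>x. Min ((\<lambda>i. u i x) ` {1..k})) in
              {w' \<in> exponential_extensions \<iota> v. qv_ring w' = qv_ring w} = {u_min} \<and>
              (\<forall>w' :: 'e \<Rightarrow> 'n with_infty.
                 wc_quasi_extension \<iota> v w' \<and> exponential w' \<and> qv_ring w' = qv_ring w \<longrightarrow>
                 (\<forall>w''. regarded_in_div_hull \<iota> v w' w'' \<longleftrightarrow> w'' = u_min)))"
    unfolding Let_def u_min_def by (intro exI[of _ k] exI[of _ u] conjI)
      (assumption | erule conjunct1 | erule conjunct2)+
qed

end
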